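(* Let $R:\widehat{\mathbb{C}}\to\widehat{\mathbb{C}}$ be any rational map of degree at least $2$, and let $x,y$ be points of $\widehat{\mathbb{C}}$ with $R(x)\neq R(y)$, such that $x$ is not a critical point of $R$. Then there exist a critical point $\zeta$ of $R$ and a Möbius map $M$ such that $M\circ R$ fixes each of $x$, $y$ and $\zeta$, and $|(M\circ R)^{\#}(x)|>\frac14$.
   Context: $\widehat{\mathbb{C}}=\mathbb{C}\cup\{\infty\}$ is the Riemann sphere. A critical point of a rational map $R$ is a point of $\widehat{\mathbb{C}}$ at which the derivative of $R$, computed in local coordinates, vanishes (equivalently, $R$ is not locally injective there). For a rational map $f$ and a point $x\in\widehat{\mathbb{C}}$ with $f(x)=x$, $f^{\#}(x)$ denotes the multiplier of $f$ at $x$, i.e. the derivative of $f$ at $x$ with respect to any local coordinate at $x$ (the same coordinate being used in source and target). *)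

theory Defs
  imports "HOL-Complex_Analysis.Complex_Analysis" "HOL-Computational_Algebra.Computational_Algebra"
begin

text \<open>
  The Riemann sphere is the one-point compactification of the complex plane: \<^term>\<open>Some z\<close> is the
  finite point \<open>z\<close> and \<^term>\<open>None\<close> is the point at infinity.
\<close>

type_synonym riemann_sphere = "complex option"

text \<open>
  The map of the sphere induced by \<open>p / q\<close>. At infinity, with \<open>n\<close> the maximum of the two degrees,
  the value is the ratio of the two coefficients of index \<open>n\<close>. This is meaningful for coprime
  \<open>p\<close> and \<open>q\<close> only, where the numerator and the denominator never vanish simultaneously.
\<close>

fun sphere_map_of_fract :: "complex poly \<Rightarrow> complex poly \<Rightarrow> riemann_sphere \<Rightarrow> riemann_sphere" where
  "sphere_map_of_fract p q (Some z) =
     (if poly q z = 0 then None else Some (poly p z / poly q z))"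
| "sphere_map_of_fract p q None =
     (let n = max (degree p) (degree q)
      in if coeff q n = 0 then None else Some (coeff p n / coeff q n))"

text \<open>A reduced fraction is determined by its map up to a constant factor, so \<open>n\<close> is unique.\<close>

definition rational_map_of_degree :: "nat \<Rightarrow> (riemann_sphere \<Rightarrow> riemann_sphere) \<Rightarrow> bool" where
  "rational_map_of_degree n R \<longleftrightarrow>
     (\<exists>p q. coprime p q \<and> n = max (degree p) (degree q) \<and> R = sphere_map_of_fract p q)"

definition moebius_map :: "(riemann_sphere \<Rightarrow> riemann_sphere) \<Rightarrow> bool" where
  "moebius_map M \<longleftrightarrow>
     (\<exists>a b c d. a * d - b * c \<noteq> 0 \<and>
        (\<forall>z. M (Some z) = (if c * z + d = 0 then None else Some (moebius a b c d z))) \<and>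
        M None = (if c = 0 then None else Some (a / c)))"

text \<open>
  \<open>sphere_coord a\<close> is the standard local coordinate around \<open>a\<close>: it is \<open>z\<close> if \<open>a\<close> is finite and \<open>1/z\<close>
  if \<open>a\<close> is infinity, and \<open>sphere_coord_inv a\<close> is its inverse. The one point outside the domain of
  the coordinate (infinity and \<open>0\<close>, respectively) is sent to \<open>0\<close>; this has no influence on
  derivatives of continuous maps.
\<close>

definition sphere_coord :: "riemann_sphere \<Rightarrow> riemann_sphere \<Rightarrow> complex" where
  "sphere_coord a w =
     (case w of None \<Rightarrow> 0 | Some z \<Rightarrow> (if a = None then inverse z else z))"

definition sphere_coord_inv :: "riemann_sphere \<Rightarrow> complex \<Rightarrow> riemann_sphere" where
  "sphere_coord_inv a z =
     (if a = None then (if z = 0 then None else Some (inverse z)) else Some z)"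

definition local_deriv ::
    "riemann_sphere \<Rightarrow> riemann_sphere \<Rightarrow> (riemann_sphere \<Rightarrow> riemann_sphere) \<Rightarrow> complex" where
  "local_deriv a b f = deriv (\<lambda>z. sphere_coord b (f (sphere_coord_inv a z))) (sphere_coord a a)"

definition critical_point :: "(riemann_sphere \<Rightarrow> riemann_sphere) \<Rightarrow> riemann_sphere \<Rightarrow> bool" where
  "critical_point R x \<longleftrightarrow> local_deriv x (R x) R = 0"

text \<open>
  The multiplier is meaningful only if \<open>f x = x\<close>. It then does not depend on the local coordinate,
  as long as the same one is used in source and target; the standard one is used here.
\<close>

definition multiplier :: "(riemann_sphere \<Rightarrow> riemann_sphere) \<Rightarrow> riemann_sphere \<Rightarrow> complex" where
  "multiplier f x = local_deriv x x f"

end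

theory Submission
  imports Defs "HOL-Computational_Algebra.Field_as_Ring"
begin

text \<open>
  Choose Moebius maps \<open>A\<close> and \<open>B\<close> with \<open>A(0) = x\<close>, \<open>A(\<infinity>) = y\<close>, \<open>B(R(x)) = 0\<close>, \<open>B(R(y)) = \<infinity>\<close>. The map
  \<open>f = B \<circ> R \<circ> A\<close> fixes \<open>0\<close> and \<open>\<infinity>\<close>. If \<open>\<zeta>\<close> is a critical point of \<open>f\<close> with \<open>f(\<zeta>) \<noteq> 0, \<infinity>\<close>, then
  \<open>w \<mapsto> (\<zeta> / f(\<zeta>)) f(w)\<close> fixes \<open>0\<close>, \<open>\<infinity>\<close> and \<open>\<zeta>\<close> and has the multiplier \<open>\<zeta> f'(0) / f(\<zeta>)\<close> at \<open>0\<close>;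
  conjugated by \<open>A\<close>, it is \<open>M \<circ> R\<close> for a Moebius map \<open>M\<close>. So the goal is a critical point \<open>\<zeta>\<close> with
  \<open>0 < |f(\<zeta>)| < 4 |\<zeta>| |f'(0)|\<close>.

  The branch \<open>g\<close> of \<open>f\<^sup>-\<^sup>1\<close> with \<open>g(0) = 0\<close> has a largest disc of existence around \<open>0\<close>, of
  radius \<open>r\<close> say. If \<open>r\<close> were infinite, then \<open>g\<close> would map the plane onto the plane, and \<open>f\<close> would
  be injective, which a rational map of degree at least \<open>2\<close> is not. For finite \<open>r\<close> there is a
  critical point \<open>\<zeta>\<close> with \<open>|f(\<zeta>)| = r\<close>: otherwise, \<open>f\<close> being proper over the plane, local inverses
  of \<open>f\<close> would continue \<open>g\<close> across each boundary point of the disc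
  (\<open>section_extends_to_larger_ball\<close>). Because \<open>f \<circ> g\<close> is the identity, \<open>g\<close> is univalent and omits
  \<open>\<zeta>\<close>, so Koebe's quarter theorem yields \<open>r / |f'(0)| = r |g'(0)| \<le> 4 |\<zeta>|\<close>. The inequality is
  strict because \<open>g\<close> is bounded: near \<open>\<infinity>\<close> one has \<open>|f| > r\<close>.

  The sharp constant in Koebe's theorem comes from an area computation. If \<open>g\<close> is univalent on the
  unit disc, \<open>g(0) = 0\<close> and \<open>g\<close> omits \<open>\<zeta>\<close>, then \<open>h = \<surd>(1 - g/\<zeta>)\<close> never takes two opposite values,
  hence \<open>F = (h - 1) / (h + 1)\<close> is univalent and never takes two reciprocal values; the claim
  becomes \<open>|F'(0)| \<le> 1\<close>. For this, measure area by \<open>dA / |w|\<^sup>2\<close>, which is invariant under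
  \<open>w \<mapsto> 1/w\<close>: the images of the ring \<open>\<epsilon> < |z| < \<rho>\<close> under \<open>F\<close> and \<open>1/F\<close> are disjoint, have the
  same area, and lie in a ring \<open>\<delta> < |w| < 1/\<delta>\<close> with \<open>\<delta>\<close> close to \<open>|F'(0)| \<epsilon>\<close>. Each image
  has area at least \<open>2\<pi> ln (\<rho>/\<epsilon>)\<close>, the big ring has area \<open>4\<pi> ln (1/\<delta>)\<close>, so \<open>\<delta> \<le> \<epsilon>/\<rho>\<close>. For
  small \<open>\<epsilon>\<close> and \<open>\<rho>\<close> close to \<open>1\<close> this gives \<open>|F'(0)| \<le> 1\<close>.
\<close>

section \<open>Plane area and holomorphic maps\<close>

text \<open>
  The theorems on integrals under a change of variables speak of \<open>real ^ n\<close>; these two maps identify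
  \<open>real ^ 2\<close> with the complex plane.
\<close>
definition complex_of :: "real ^ 2 \<Rightarrow> complex" where "complex_of v = Complex (v $ 1) (v $ 2)"
definition vec_of :: "complex \<Rightarrow> real ^ 2" where "vec_of z = vector [Re z, Im z]"

lemma complex_of_vec_of [simp]: "complex_of (vec_of z) = z"
  by (simp add: complex_of_def vec_of_def complex_eq_iff)

lemma vec_of_complex_of [simp]: "vec_of (complex_of v) = v"
  by (simp add: complex_of_def vec_of_def vec_eq_iff forall_2)

lemma linear_complex_of: "linear complex_of"
  by (auto simp: complex_of_def complex_eq_iff intro!: linearI)

lemma linear_vec_of: "linear vec_of"
  by (auto simp: vec_of_def vec_eq_iff forall_2 intro!: linearI)

lemma bounded_linear_complex_of: "bounded_linear complex_of" and bounded_linear_vec_of: "bounded_linear vec_of"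
  using linear_complex_of linear_vec_of linear_linear by blast+

lemma inj_vec_of: "inj vec_of"
  by (metis complex_of_vec_of injI)

lemma vec_of_image: "vec_of ` S = complex_of -` S"
  by (force simp: image_iff)

lemma open_vec_of_image: "open S \<Longrightarrow> open (vec_of ` S)"
  unfolding vec_of_image
  by (intro open_vimage linear_continuous_on bounded_linear_complex_of)

text \<open>
  Multiplication by \<open>d\<close> is a rotation composed with a scaling by \<open>|d|\<close>, so it multiplies areas by
  \<open>|d|\<^sup>2\<close>.
\<close>
lemma det_vec_of_mult: "det (matrix (\<lambda>h. vec_of (d * complex_of h))) = (cmod d)\<^sup>2"
  by (simp add: det_2 matrix_def vec_of_def complex_of_def axis_def cmod_power2 flip: power2_eq_square)

text \<open>
  The Jacobian determinant of a holomorphic map is \<open>|\<phi>'|\<^sup>2\<close> by the Cauchy-Riemann equations. The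
  equivalence is used in both directions: for \<open>exp\<close> on a box, integrability is known on
  the domain; for a univalent map with values in a ring it is known on the image.
\<close>
lemma holomorphic_change_of_variables:
  fixes f :: "complex \<Rightarrow> real"
  assumes S: "open S" and hol: "\<phi> holomorphic_on S" and inj: "inj_on \<phi> S"
  shows "(\<lambda>v. (cmod (deriv \<phi> (complex_of v)))\<^sup>2 * f (\<phi> (complex_of v))) absolutely_integrable_on (vec_of ` S) \<and>
         integral (vec_of ` S) (\<lambda>v. (cmod (deriv \<phi> (complex_of v)))\<^sup>2 * f (\<phi> (complex_of v))) = b
     \<longleftrightarrow> (\<lambda>v. f (complex_of v)) absolutely_integrable_on (vec_of ` \<phi> ` S) \<and>
         integral (vec_of ` \<phi> ` S) (\<lambda>v. f (complex_of v)) = b"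
proof -
  let ?g = "\<lambda>v. vec_of (\<phi> (complex_of v))"
  let ?g' = "\<lambda>v h. vec_of (deriv \<phi> (complex_of v) * complex_of h)"
  have "vec_of ` S \<in> sets lebesgue"
    using open_vec_of_image[OF S] by (simp add: lborelD)
  moreover have "(?g has_derivative ?g' v) (at v within vec_of ` S)" if "v \<in> vec_of ` S" for v
  proof -
    from that have "complex_of v \<in> S" by auto
    then have "(\<phi> has_derivative (*) (deriv \<phi> (complex_of v))) (at (complex_of v))"
      using holomorphic_derivI[OF hol S] by (simp add: has_field_derivative_def)
    then have "((\<lambda>v. \<phi> (complex_of v)) has_derivative (\<lambda>h. deriv \<phi> (complex_of v) * complex_of h)) (at v within vec_of ` S)"
      using has_derivative_compose[OF bounded_linear_imp_has_derivative[OF bounded_linear_complex_of]] by blast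
    then show ?thesis
      by (rule bounded_linear.has_derivative[OF bounded_linear_vec_of])
  qed
  moreover have "inj_on ?g (vec_of ` S)"
    using inj inj_vec_of by (auto simp: inj_on_def)
  ultimately have "(\<lambda>v. \<bar>det (matrix (?g' v))\<bar> *\<^sub>R (vec (f (complex_of (?g v))) :: real ^ 1)) absolutely_integrable_on (vec_of ` S) \<and>
        integral (vec_of ` S) (\<lambda>v. \<bar>det (matrix (?g' v))\<bar> *\<^sub>R (vec (f (complex_of (?g v))) :: real ^ 1)) = vec b
     \<longleftrightarrow> (\<lambda>v. vec (f (complex_of v)) :: real ^ 1) absolutely_integrable_on (?g ` vec_of ` S) \<and>
        integral (?g ` vec_of ` S) (\<lambda>v. vec (f (complex_of v)) :: real ^ 1) = vec b"
    by (rule has_absolute_integral_change_of_variables)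
  moreover have "?g ` vec_of ` S = vec_of ` \<phi> ` S"
    by (auto simp: image_image)
  ultimately show ?thesis
    by (simp add: det_vec_of_mult absolutely_integrable_on_1_iff integral_on_1_eq vec_eq_iff o_def)
qed

lemma vec_of_nth [simp]: "vec_of z $ 1 = Re z" "vec_of z $ 2 = Im z"
  by (simp_all add: vec_of_def)

lemma mem_box_complex_iff: "z \<in> box a b \<longleftrightarrow> Re a < Re z \<and> Re z < Re b \<and> Im a < Im z \<and> Im z < Im b"
  by (auto simp: mem_box Basis_complex_def)

lemma vec_of_box: "vec_of ` box a b = box (vec_of a) (vec_of b)"
proof -
  have "v \<in> vec_of ` box a b \<longleftrightarrow> v \<in> box (vec_of a) (vec_of b)" for v
    unfolding vec_of_image
    by (auto simp: mem_box_cart forall_2 mem_box_complex_iff complex_of_def)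
  then show ?thesis by blast
qed

lemma content_vec_of_box:
  assumes "Re a \<le> Re b" "Im a \<le> Im b"
  shows "measure lborel (box (vec_of a) (vec_of b)) = (Re b - Re a) * (Im b - Im a)"
proof -
  have "cbox (vec_of a) (vec_of b) \<noteq> {}"
    using assms by (auto simp: interval_ne_empty_cart forall_2)
  then have "measure lborel (cbox (vec_of a) (vec_of b)) = (Re b - Re a) * (Im b - Im a)"
    by (simp add: content_cbox_cart UNIV_2)
  then show ?thesis by (simp add: measure_lborel_box_eq measure_lborel_cbox_eq)
qed

text \<open>
  Fubini's theorem for a rectangle, transported from \<open>real \<times> real\<close> by the identification
  with \<open>real ^ 2\<close>, which preserves the content of boxes.
\<close>
lemma integral_vec_of_cbox:
  fixes f :: "complex \<Rightarrow> real"
  assumes f: "continuous_on (cbox a b) f"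
  shows "((\<lambda>v. f (complex_of v)) has_integral
      integral {Re a..Re b} (\<lambda>x. integral {Im a..Im b} (\<lambda>y. f (Complex x y)))) (cbox (vec_of a) (vec_of b))"
proof -
  let ?C = "cbox (Re a, Im a) (Re b, Im b)"
  let ?f = "\<lambda>p. f (Complex (fst p) (snd p))"
  let ?g = "\<lambda>v :: real ^ 2. (v $ 1, v $ 2)"
  let ?h = "\<lambda>p :: real \<times> real. vec_of (Complex (fst p) (snd p))"
  have cont: "continuous_on ?C ?f"
  proof (rule continuous_on_compose2[OF f])
    show "continuous_on ?C (\<lambda>p. Complex (fst p) (snd p))"
      by (intro continuous_intros)
    show "(\<lambda>p. Complex (fst p) (snd p)) ` ?C \<subseteq> cbox a b"
      by (auto simp: mem_box Basis_complex_def cbox_Pair_eq)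
  qed
  then have "(?f has_integral integral {Re a..Re b} (\<lambda>x. integral {Im a..Im b} (\<lambda>y. f (Complex x y)))) ?C"
    using integral_prod_continuous[OF cont] integrable_continuous[OF cont] by (simp add: has_integral_integral)
  have gimg: "?g ` cbox u v = cbox (u $ 1, u $ 2) (v $ 1, v $ 2)" for u v
  proof -
    have "p \<in> ?g ` cbox u v \<longleftrightarrow> p \<in> cbox (u $ 1, u $ 2) (v $ 1, v $ 2)" for p
      by (cases p) (auto simp: image_iff mem_box_cart forall_2 cbox_Pair_eq
          intro!: exI[of _ "vec_of (Complex (fst p) (snd p))"] bexI[of _ "vec_of (Complex (fst p) (snd p))"])
    then show ?thesis by blast
  qed
  have himg: "?h ` cbox u v = cbox (?h u) (?h v)" for u v
  proof -
    have "w \<in> ?h ` cbox u v \<longleftrightarrow> w \<in> cbox (?h u) (?h v)" for w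
      by (cases u; cases v) (auto simp: image_iff mem_box_cart forall_2 cbox_Pair_eq vec_eq_iff
          intro!: bexI[of _ "(w $ 1, w $ 2)"])
    then show ?thesis by blast
  qed
  have ex_2: "(\<exists>i :: 2. P i) \<longleftrightarrow> P 1 \<or> P 2" for P
    by (metis exhaust_2)
  have content: "measure lborel (?g ` cbox u v) = 1 * measure lborel (cbox u v)" for u v
    unfolding gimg
    by (auto simp: content_cbox_if_cart UNIV_2 content_Pair content_real_if interval_eq_empty_cart ex_2)
  have "((\<lambda>v. ?f (?g v)) has_integral (1 / 1) *\<^sub>R integral {Re a..Re b} (\<lambda>x. integral {Im a..Im b} (\<lambda>y. f (Complex x y))))
     (?h ` ?C)"
  proof (rule has_integral_twiddle)
    show "\<exists>w z. ?g ` cbox u v = cbox w z" for u v unfolding gimg by blast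
    show "\<exists>w z. ?h ` cbox u v = cbox w z" for u v unfolding himg by blast
    show "continuous (at v) ?g" for v by (intro continuous_intros)
  qed (fact | simp add: vec_eq_iff forall_2)+
  moreover have "?h ` ?C = cbox (vec_of a) (vec_of b)"
    unfolding himg by simp
  ultimately show ?thesis by (simp add: complex_of_def)
qed
section \<open>Logarithmic area\<close>

text \<open>
  The integrand is \<open>\<partial>/\<partial>y Im K(exp(x + iy))\<close>, and the function \<open>y \<mapsto> K(exp(x + iy))\<close> takes the same
  value at \<open>0\<close> and \<open>2\<pi>\<close>; so already every inner integral in Fubini's theorem vanishes.
\<close>
lemma integral_exp_derivative_eq_0:
  assumes K: "K holomorphic_on ball 0 1" and ab: "b < 0"
  shows "((\<lambda>v. Re (exp (complex_of v) * deriv K (exp (complex_of v)))) has_integral 0)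
           (cbox (vec_of (Complex a 0)) (vec_of (Complex b (2 * pi))))"
proof -
  let ?f = "\<lambda>s. Re (exp s * deriv K (exp s))"
  have K': "deriv K holomorphic_on ball 0 1"
    using K by (intro holomorphic_deriv) auto
  have mem: "exp s \<in> ball 0 1" if "Re s \<le> b" for s
    using that ab by simp
  have "continuous_on (cbox (Complex a 0) (Complex b (2 * pi))) ?f"
    by (intro continuous_intros continuous_on_compose2[OF holomorphic_on_imp_continuous_on[OF K']])
       (auto simp: mem_box Basis_complex_def intro!: mem)
  from integral_vec_of_cbox[OF this]
  have "((\<lambda>v. ?f (complex_of v)) has_integral
          integral {a..b} (\<lambda>x. integral {0..2 * pi} (\<lambda>y. ?f (Complex x y))))
          (cbox (vec_of (Complex a 0)) (vec_of (Complex b (2 * pi))))"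
    by simp
  moreover have "integral {0..2 * pi} (\<lambda>y. ?f (Complex x y)) = 0" if "x \<in> {a..b}" for x
  proof -
    have "((\<lambda>y. ?f (Complex x y)) has_integral
            Im (K (exp (Complex x (2 * pi)))) - Im (K (exp (Complex x 0)))) {0..2 * pi}"
    proof (rule fundamental_theorem_of_calculus)
      fix y :: real
      assume "y \<in> {0..2 * pi}"
      have c: "((\<lambda>y. Complex x y) has_vector_derivative \<i>) (at y within {0..2 * pi})"
        unfolding Complex_eq by (auto intro!: derivative_eq_intros)
      have "(K has_field_derivative deriv K (exp (Complex x y))) (at (exp (Complex x y)))"
        using holomorphic_derivI[OF K _ mem[of "Complex x y"]] that by auto
      from DERIV_chain[OF this DERIV_exp]
      have "((\<lambda>s. K (exp s)) has_field_derivative deriv K (exp (Complex x y)) * exp (Complex x y)) (at (Complex x y))"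
        by (simp add: o_def)
      from field_vector_diff_chain_within[OF c has_field_derivative_at_within[OF this]]
      have "((\<lambda>y. K (exp (Complex x y))) has_vector_derivative \<i> * (deriv K (exp (Complex x y)) * exp (Complex x y)))
         (at y within {0..2 * pi})"
        by (simp add: o_def)
      from bounded_linear.has_vector_derivative[OF bounded_linear_Im this]
      show "((\<lambda>y. Im (K (exp (Complex x y)))) has_vector_derivative ?f (Complex x y)) (at y within {0..2 * pi})"
        by (simp add: mult.commute)
    qed simp
    then show ?thesis
      by (auto simp: integral_unique exp_eq_polar)
  qed
  then have "integral {a..b} (\<lambda>x. integral {0..2 * pi} (\<lambda>y. ?f (Complex x y))) = integral {a..b} (\<lambda>x. 0)"
    by (rule integral_cong)
  ultimately show ?thesis
    by (simp only: integral_0)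
qed

text \<open>
  The open box has height \<open>2\<pi>\<close>, the most that leaves \<open>exp\<close> injective. Its image misses the negative
  real axis, which therefore has to be added.
\<close>
lemma exp_image_annulus:
  "{w. exp a < cmod w \<and> cmod w < exp b} \<subseteq> exp ` box (Complex a (-pi)) (Complex b pi) \<union> {w. Im w = 0}"
proof
  fix w assume w: "w \<in> {w. exp a < cmod w \<and> cmod w < exp b}"
  then have w0: "w \<noteq> 0" by (auto simp: not_less dest: order.strict_trans[of _ 0])
  show "w \<in> exp ` box (Complex a (-pi)) (Complex b pi) \<union> {w. Im w = 0}"
  proof (cases "Im (Ln w) = pi")
    case True
    then show ?thesis using w0 by (simp add: Im_Ln_eq_pi)
  next
    case False
    have "a < Re (Ln w)" "Re (Ln w) < b"
      using w w0 by (simp_all flip: exp_less_cancel_iff[of a] exp_less_cancel_iff[of _ b])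
    then have "Ln w \<in> box (Complex a (-pi)) (Complex b pi)"
      using mpi_less_Im_Ln[OF w0] Im_Ln_le_pi[OF w0] False by (simp add: mem_box_complex_iff)
    then show ?thesis using exp_Ln[OF w0] by (metis Un_iff imageI)
  qed
qed

text \<open>
  \<open>F(z)/z\<close> extends to a zero-free function on the disc: away from \<open>0\<close> because \<open>F\<close> has its only zero
  at \<open>0\<close>, and at \<open>0\<close> because the derivative of a univalent function has no zero.
\<close>
lemma univalent_eq_times_exp:
  assumes hol: "F holomorphic_on ball 0 1" and inj: "inj_on F (ball 0 1)" and F0: "F 0 = 0"
  obtains K where "K holomorphic_on ball 0 1" "\<And>z. z \<in> ball 0 1 \<Longrightarrow> F z = z * exp (K z)"
proof -
  define k where "k = (\<lambda>z. if z = 0 then deriv F 0 else F z / z)"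
  have "k holomorphic_on ball 0 1"
    by (rule pole_theorem_open_0[OF hol, of 0]) (auto simp: k_def F0)
  moreover have "k z \<noteq> 0" if "z \<in> ball 0 1" for z
    using that inj_onD[OF inj, of z 0] holomorphic_injective_imp_regular[OF hol _ inj, of 0]
    by (auto simp: k_def F0)
  ultimately obtain K where K: "K holomorphic_on ball 0 1" "\<And>z. z \<in> ball 0 1 \<Longrightarrow> k z = exp (K z)"
    using contractible_imp_holomorphic_log[OF _ convex_imp_contractible[OF convex_ball]] by metis
  then have "F z = z * exp (K z)" if "z \<in> ball 0 1" for z
    using K(2)[OF that] by (auto simp: k_def F0 field_simps split: if_splits)
  with K that show ?thesis by blast
qed

text \<open>
  In the coordinate \<open>s = ln w\<close> the measure \<open>dA / |w|\<^sup>2\<close> is the ordinary area \<open>dA\<close>. Hence the ring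
  \<open>exp a < |w| < exp b\<close> has the area of a box with sides \<open>b - a\<close> and \<open>2\<pi>\<close>. Adding the real
  axis, a null set, makes the whole ring a subset of the domain of integration.
\<close>
lemma abs_integrable_inverse_square:
  assumes "a \<le> b"
  shows "(\<lambda>v. 1 / (cmod (complex_of v))\<^sup>2) absolutely_integrable_on
            (vec_of ` (exp ` box (Complex a (-pi)) (Complex b pi) \<union> {w. Im w = 0}))" (is ?int)
    and "integral (vec_of ` (exp ` box (Complex a (-pi)) (Complex b pi) \<union> {w. Im w = 0}))
           (\<lambda>v. 1 / (cmod (complex_of v))\<^sup>2) = 2 * pi * (b - a)" (is ?val)
proof -
  let ?f = "\<lambda>w. 1 / (cmod w)\<^sup>2"
  let ?Q = "box (Complex a (-pi)) (Complex b pi)"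
  have inj: "inj_on exp ?Q"
    by (rule inj_onI, rule exp_complex_eqI) (auto simp: mem_box_complex_iff)
  have deriv_exp: "deriv exp s = exp s" for s :: complex
    by (rule DERIV_imp_deriv[OF DERIV_exp])
  have Q: "vec_of ` ?Q \<in> lmeasurable"
    by (simp add: vec_of_box)
  have "(\<lambda>v. (cmod (deriv exp (complex_of v)))\<^sup>2 * ?f (exp (complex_of v))) absolutely_integrable_on vec_of ` ?Q \<and>
        integral (vec_of ` ?Q) (\<lambda>v. (cmod (deriv exp (complex_of v)))\<^sup>2 * ?f (exp (complex_of v))) = 2 * pi * (b - a)"
    using absolutely_integrable_on_const[OF Q, of "1 :: real"] lmeasure_integral[OF Q] assms
      content_vec_of_box[of "Complex a (-pi)" "Complex b pi"]
    by (simp add: vec_of_box mult.commute deriv_exp)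
  then have 1: "(\<lambda>v. ?f (complex_of v)) absolutely_integrable_on vec_of ` exp ` ?Q \<and>
        integral (vec_of ` exp ` ?Q) (\<lambda>v. ?f (complex_of v)) = 2 * pi * (b - a)"
    by (subst (asm) holomorphic_change_of_variables) (auto intro: holomorphic_intros inj)
  have "vec_of ` {w. Im w = 0} = {v. v $ 2 = 0}"
    by (auto simp: vec_of_image complex_of_def)
  then have neg: "negligible (vec_of ` {w. Im w = 0})"
    by (simp add: negligible_standard_hyperplane_cart)
  \<comment> \<open>The two domains of integration differ by part of the real axis only.\<close>
  have neg1: "negligible {x \<in> vec_of ` exp ` ?Q - vec_of ` (exp ` ?Q \<union> {w. Im w = 0}). ?f (complex_of x) \<noteq> 0}"
    by (rule negligible_subset[of "{}"]) auto
  have neg2: "negligible {x \<in> vec_of ` (exp ` ?Q \<union> {w. Im w = 0}) - vec_of ` exp ` ?Q. ?f (complex_of x) \<noteq> 0}"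
    by (rule negligible_subset[OF neg]) auto
  show ?int
    by (rule absolutely_integrable_spike_set[OF conjunct1[OF 1] neg1 neg2])
  show ?val
    using integral_spike_set[OF neg1 neg2] 1 by simp
qed

text \<open>
  Write \<open>E = F \<circ> exp\<close> on the box \<open>A\<close> that \<open>exp\<close> maps onto the slit ring \<open>\<epsilon> < |z| < \<rho>\<close>. The images
  \<open>E(A)\<close> and \<open>1/E(A)\<close> are disjoint subsets of the ring \<open>\<delta> < |w| < 1/\<delta>\<close>, whose logarithmic area is
  \<open>4\<pi> ln (1/\<delta>)\<close>. Both have the logarithmic area \<open>\<integral>\<^sub>A |\<omega>|\<^sup>2\<close>, where \<open>\<omega> = E'/E\<close> is the logarithmic
  derivative. With \<open>F(z) = z exp(K(z))\<close> one gets \<open>\<omega> = 1 + exp(s) K'(exp(s))\<close>, a function with mean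
  value \<open>1\<close> over \<open>A\<close>. As \<open>|\<omega>|\<^sup>2 \<ge> 2 Re \<omega> - 1\<close>, the integral is at least the area \<open>2\<pi> ln (\<rho>/\<epsilon>)\<close>
  of \<open>A\<close>.
\<close>
lemma log_area_inequality:
  assumes hol: "F holomorphic_on ball 0 1" and inj: "inj_on F (ball 0 1)" and F0: "F 0 = 0"
    and prod: "\<And>z w. z \<in> ball 0 1 \<Longrightarrow> w \<in> ball 0 1 \<Longrightarrow> F z * F w \<noteq> 1"
    and eps: "0 < \<epsilon>" "\<epsilon> < \<rho>" "\<rho> < 1"
    and \<delta>: "0 < \<delta>" "\<And>z. \<epsilon> < cmod z \<Longrightarrow> cmod z < \<rho> \<Longrightarrow> \<delta> < cmod (F z) \<and> cmod (F z) < 1 / \<delta>"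
  shows "\<delta> \<le> \<epsilon> / \<rho>"
proof -
  obtain K where K: "K holomorphic_on ball 0 1" and FK: "\<And>z. z \<in> ball 0 1 \<Longrightarrow> F z = z * exp (K z)"
    using univalent_eq_times_exp[OF hol inj F0] by blast
  let ?A = "box (Complex (ln \<epsilon>) 0) (Complex (ln \<rho>) (2 * pi))"
  let ?f = "\<lambda>w. 1 / (cmod w)\<^sup>2"
  define E where "E = (\<lambda>s. F (exp s))"
  define \<omega> where "\<omega> = (\<lambda>s. 1 + exp s * deriv K (exp s))"
  have ln_lt: "ln \<epsilon> < ln \<rho>" "ln \<rho> < 0" using eps by auto
  have Re_neg: "Re s < 0" if "s \<in> ?A" for s
    using that ln_lt by (auto simp: mem_box_complex_iff)
  have exp_mem: "exp s \<in> ball 0 1" if "Re s < 0" for s :: complex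
    using that by simp
  have exp_annulus: "\<epsilon> < cmod (exp s) \<and> cmod (exp s) < \<rho>" if "s \<in> ?A" for s
    using that eps exp_less_mono[of "ln \<epsilon>" "Re s"] exp_less_mono[of "Re s" "ln \<rho>"]
    by (simp add: mem_box_complex_iff)
  have E_bounds: "\<delta> < cmod (E s) \<and> cmod (E s) < 1 / \<delta>" if "s \<in> ?A" for s
    using \<delta>(2) exp_annulus[OF that] by (simp add: E_def)
  then have E0: "E s \<noteq> 0" if "s \<in> ?A" for s
    using that \<delta>(1) by fastforce
  have dE: "(E has_field_derivative E s * \<omega> s) (at s)" if "Re s < 0" for s
  proof -
    have "\<forall>\<^sub>F s :: complex in nhds s. Re s < 0"
      using eventually_nhds_in_open[OF open_halfspace_Re_lt[of 0], of s] that by simp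
    then have ev: "\<forall>\<^sub>F s in nhds s. E s = exp s * exp (K (exp s))"
      by (rule eventually_mono) (simp add: E_def FK exp_mem)
    have "((\<lambda>s. K (exp s)) has_field_derivative deriv K (exp s) * exp s) (at s)"
      using DERIV_chain[OF holomorphic_derivI[OF K _ exp_mem[OF that]] DERIV_exp] by (simp add: o_def)
    then have "((\<lambda>s. exp s * exp (K (exp s))) has_field_derivative E s * \<omega> s) (at s)"
      using exp_mem[OF that] by (auto intro!: derivative_eq_intros simp: \<omega>_def E_def FK algebra_simps)
    then show ?thesis
      using DERIV_cong_ev[OF refl ev refl] by blast
  qed
  have hol1: "E holomorphic_on ?A"
    using dE[OF Re_neg] holomorphic_on_open[OF open_box] by blast
  have hol2: "(\<lambda>s. inverse (E s)) holomorphic_on ?A"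
    using hol1 E0 by (rule holomorphic_on_inverse)
  have inj1: "inj_on E ?A"
  proof (rule inj_onI)
    fix s t assume st: "s \<in> ?A" "t \<in> ?A" "E s = E t"
    then have "exp s = exp t"
      unfolding E_def using inj_onD[OF inj] exp_mem[OF Re_neg] by blast
    then show "s = t"
      by (rule exp_complex_eqI[rotated]) (use st in \<open>auto simp: mem_box_complex_iff\<close>)
  qed
  then have inj2: "inj_on (\<lambda>s. inverse (E s)) ?A"
    by (auto simp: inj_on_def)
  have weight1: "(cmod (deriv E s))\<^sup>2 * ?f (E s) = (cmod (\<omega> s))\<^sup>2" if "s \<in> ?A" for s
    using DERIV_imp_deriv[OF dE[OF Re_neg[OF that]]] E0[OF that]
    by (simp add: norm_mult power_mult_distrib)
  have weight2: "(cmod (deriv (\<lambda>s. inverse (E s)) s))\<^sup>2 * ?f (inverse (E s)) = (cmod (\<omega> s))\<^sup>2" if "s \<in> ?A" for s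
  proof -
    have "((\<lambda>s. inverse (E s)) has_field_derivative - (\<omega> s / E s)) (at s)"
      using dE[OF Re_neg[OF that]] E0[OF that]
      by (auto intro!: derivative_eq_intros simp: field_simps)
    from DERIV_imp_deriv[OF this] show ?thesis
      using E0[OF that] by (simp add: norm_divide norm_inverse power_divide power_inverse)
  qed
  let ?X1 = "E ` ?A" and ?X2 = "(\<lambda>s. inverse (E s)) ` ?A"
  let ?Y = "exp ` box (Complex (ln \<delta>) (-pi)) (Complex (- ln \<delta>) pi) \<union> {w. Im w = 0}"
  have annulus: "w \<in> ?Y" if "\<delta> < cmod w" "cmod w < 1 / \<delta>" for w
    using subsetD[OF exp_image_annulus[of "ln \<delta>" "- ln \<delta>"], of w] that \<delta>(1)
    by (simp add: exp_minus divide_inverse)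
  have sub1: "?X1 \<subseteq> ?Y"
    using E_bounds annulus by blast
  have sub2: "?X2 \<subseteq> ?Y"
  proof (intro image_subsetI annulus)
    fix s assume s: "s \<in> ?A"
    show "\<delta> < cmod (inverse (E s))" "cmod (inverse (E s)) < 1 / \<delta>"
      using E_bounds[OF s] E0[OF s] \<delta>(1) unfolding norm_inverse by (simp_all add: field_simps)
  qed
  have disj: "vec_of ` ?X1 \<inter> vec_of ` ?X2 = {}"
  proof -
    have "E s * E t \<noteq> 1" if "s \<in> ?A" "t \<in> ?A" for s t
      unfolding E_def using prod exp_mem[OF Re_neg] that by blast
    then have "E s \<noteq> inverse (E t)" if "s \<in> ?A" "t \<in> ?A" for s t
      using that E0 by (metis left_inverse)
    then have "?X1 \<inter> ?X2 = {}" by blast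
    then show ?thesis by (simp add: image_Int[OF inj_vec_of, symmetric])
  qed
  have \<delta>1: "ln \<delta> \<le> - ln \<delta>"
  proof -
    obtain s where "s \<in> ?A"
      using ln_lt by (auto simp: mem_box_complex_iff intro!: that[of "Complex ((ln \<epsilon> + ln \<rho>) / 2) pi"])
    then have "\<delta> < 1 / \<delta>" using E_bounds by force
    then have "\<delta>\<^sup>2 < 1" using \<delta>(1) by (simp add: field_simps power2_eq_square)
    then have "\<delta> < 1" using abs_square_less_1[of \<delta>] \<delta>(1) by simp
    then show ?thesis using \<delta>(1) by simp
  qed
  note Y = abs_integrable_inverse_square[OF \<delta>1]
  have leb1: "vec_of ` ?X1 \<in> sets lebesgue" and leb2: "vec_of ` ?X2 \<in> sets lebesgue"
    using open_vec_of_image[OF open_mapping_thm3[OF hol1 open_box inj1]]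
      open_vec_of_image[OF open_mapping_thm3[OF hol2 open_box inj2]] by (auto simp: lborelD)
  have ai1: "(\<lambda>v. ?f (complex_of v)) absolutely_integrable_on vec_of ` ?X1"
    by (rule set_integrable_subset[OF Y(1) leb1 image_mono[OF sub1]])
  have ai2: "(\<lambda>v. ?f (complex_of v)) absolutely_integrable_on vec_of ` ?X2"
    by (rule set_integrable_subset[OF Y(1) leb2 image_mono[OF sub2]])
  note i1 = set_lebesgue_integral_eq_integral(1)[OF ai1] and i2 = set_lebesgue_integral_eq_integral(1)[OF ai2]
  have "integral (vec_of ` ?X1) (\<lambda>v. ?f (complex_of v)) + integral (vec_of ` ?X2) (\<lambda>v. ?f (complex_of v))
      = integral (vec_of ` ?X1 \<union> vec_of ` ?X2) (\<lambda>v. ?f (complex_of v))"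
    using i1 i2 disj by (subst integral_Un) auto
  also have "\<dots> \<le> integral (vec_of ` ?Y) (\<lambda>v. ?f (complex_of v))"
    using sub1 sub2 set_lebesgue_integral_eq_integral(1)[OF Y(1)] i1 i2 disj
    by (intro integral_subset_le integrable_Un) auto
  finally have le: "integral (vec_of ` ?X1) (\<lambda>v. ?f (complex_of v)) + integral (vec_of ` ?X2) (\<lambda>v. ?f (complex_of v))
      \<le> 2 * pi * (- 2 * ln \<delta>)"
    using Y(2) by simp
  have w1: "(cmod (deriv E (complex_of v)))\<^sup>2 * ?f (E (complex_of v)) = (cmod (\<omega> (complex_of v)))\<^sup>2"
    and w2: "(cmod (deriv (\<lambda>s. inverse (E s)) (complex_of v)))\<^sup>2 * ?f (inverse (E (complex_of v))) = (cmod (\<omega> (complex_of v)))\<^sup>2"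
    if "v \<in> vec_of ` ?A" for v
    using that weight1[of "complex_of v"] weight2[of "complex_of v"] unfolding vec_of_image vimage_def by blast+
  have c1: "(\<lambda>v. (cmod (deriv E (complex_of v)))\<^sup>2 * ?f (E (complex_of v))) absolutely_integrable_on vec_of ` ?A \<and>
      integral (vec_of ` ?A) (\<lambda>v. (cmod (deriv E (complex_of v)))\<^sup>2 * ?f (E (complex_of v))) = integral (vec_of ` ?X1) (\<lambda>v. ?f (complex_of v))"
    by (rule iffD2[OF holomorphic_change_of_variables[OF open_box hol1 inj1] conjI[OF ai1 refl]])
  have c2: "(\<lambda>v. (cmod (deriv (\<lambda>s. inverse (E s)) (complex_of v)))\<^sup>2 * ?f (inverse (E (complex_of v)))) absolutely_integrable_on vec_of ` ?A \<and>
      integral (vec_of ` ?A) (\<lambda>v. (cmod (deriv (\<lambda>s. inverse (E s)) (complex_of v)))\<^sup>2 * ?f (inverse (E (complex_of v)))) = integral (vec_of ` ?X2) (\<lambda>v. ?f (complex_of v))"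
    by (rule iffD2[OF holomorphic_change_of_variables[OF open_box hol2 inj2] conjI[OF ai2 refl]])
  have "(\<lambda>v. (cmod (\<omega> (complex_of v)))\<^sup>2) integrable_on vec_of ` ?A"
    using set_lebesgue_integral_eq_integral(1)[OF conjunct1[OF c1]] w1 by (rule integrable_eq)
  moreover have "integral (vec_of ` ?A) (\<lambda>v. (cmod (\<omega> (complex_of v)))\<^sup>2) = integral (vec_of ` ?X1) (\<lambda>v. ?f (complex_of v))"
    by (rule trans[OF integral_cong[OF w1[symmetric]] conjunct2[OF c1]])
  moreover have "integral (vec_of ` ?A) (\<lambda>v. (cmod (\<omega> (complex_of v)))\<^sup>2) = integral (vec_of ` ?X2) (\<lambda>v. ?f (complex_of v))"
    by (rule trans[OF integral_cong[OF w2[symmetric]] conjunct2[OF c2]])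
  ultimately have \<omega>_int: "(\<lambda>v. (cmod (\<omega> (complex_of v)))\<^sup>2) integrable_on vec_of ` ?A"
    and \<omega>_le: "integral (vec_of ` ?A) (\<lambda>v. (cmod (\<omega> (complex_of v)))\<^sup>2) \<le> 2 * pi * (- ln \<delta>)"
    using le by (simp_all add: algebra_simps)
  have "((\<lambda>v. 1 + 2 * Re (exp (complex_of v) * deriv K (exp (complex_of v)))) has_integral
      measure lborel (cbox (vec_of (Complex (ln \<epsilon>) 0)) (vec_of (Complex (ln \<rho>) (2 * pi)))) + 2 * 0)
      (cbox (vec_of (Complex (ln \<epsilon>) 0)) (vec_of (Complex (ln \<rho>) (2 * pi))))"
    using has_integral_const[of "1 :: real" "vec_of (Complex (ln \<epsilon>) 0)" "vec_of (Complex (ln \<rho>) (2 * pi))"]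
    by (intro has_integral_add has_integral_mult_right integral_exp_derivative_eq_0 K ln_lt) simp_all
  then have "((\<lambda>v. 1 + 2 * Re (exp (complex_of v) * deriv K (exp (complex_of v)))) has_integral
      2 * pi * (ln \<rho> - ln \<epsilon>)) (vec_of ` ?A)"
    using content_vec_of_box[of "Complex (ln \<epsilon>) 0" "Complex (ln \<rho>) (2 * pi)"] ln_lt
    by (simp add: vec_of_box has_integral_open_interval measure_lborel_box_eq measure_lborel_cbox_eq mult.commute)
  then have "2 * pi * (ln \<rho> - ln \<epsilon>) \<le> integral (vec_of ` ?A) (\<lambda>v. (cmod (\<omega> (complex_of v)))\<^sup>2)"
  proof (rule has_integral_le[OF _ integrable_integral[OF \<omega>_int]])
    fix v
    have "1 + 2 * Re u \<le> (cmod (1 + u))\<^sup>2" for u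
      by (simp add: cmod_power2 power2_sum)
    then show "1 + 2 * Re (exp (complex_of v) * deriv K (exp (complex_of v))) \<le> (cmod (\<omega> (complex_of v)))\<^sup>2"
      unfolding \<omega>_def .
  qed
  then have "2 * pi * (ln \<rho> - ln \<epsilon>) \<le> 2 * pi * (- ln \<delta>)"
    using \<omega>_le by (rule order_trans)
  then have "ln \<rho> - ln \<epsilon> \<le> - ln \<delta>"
    by (rule mult_left_le_imp_le) simp
  moreover have "ln (\<epsilon> / \<rho>) = ln \<epsilon> - ln \<rho>"
    using eps by (simp add: ln_div)
  ultimately have "ln \<delta> \<le> ln (\<epsilon> / \<rho>)"
    by linarith
  moreover have "0 < \<epsilon> / \<rho>"
    using eps by simp
  ultimately show ?thesis
    using \<delta>(1) by (simp only: ln_le_cancel_iff)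
qed
section \<open>Koebe's quarter theorem\<close>

text \<open>
  If \<open>|F'(0)| > c > 1\<close>, then \<open>|F(z)| > c \<epsilon>\<close> on a small circle \<open>|z| = \<epsilon>\<close>, so the image of the disc
  \<open>|z| < \<epsilon>\<close> covers the disc \<open>|w| < c \<epsilon>\<close>. Outside \<open>|z| < \<epsilon>\<close>, injectivity keeps \<open>F\<close> out of the
  latter disc, and the hypothesis on products does the same for \<open>1/F\<close>. Now the logarithmic area
  inequality yields \<open>\<delta> \<le> \<epsilon> / \<rho>\<close> for each \<open>\<delta> < c \<epsilon>\<close>, which fails for \<open>\<rho>\<close> close to \<open>1\<close>.
\<close>
theorem univalent_Bieberbach_Eilenberg:
  assumes hol: "F holomorphic_on ball 0 1" and inj: "inj_on F (ball 0 1)" and F0: "F 0 = 0"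
    and prod: "\<And>z w. z \<in> ball 0 1 \<Longrightarrow> w \<in> ball 0 1 \<Longrightarrow> F z * F w \<noteq> 1"
  shows "cmod (deriv F 0) \<le> 1"
proof (rule ccontr)
  assume "\<not> cmod (deriv F 0) \<le> 1"
  then have gt: "1 < cmod (deriv F 0)" by simp
  obtain K where K: "K holomorphic_on ball 0 1" and FK: "\<And>z. z \<in> ball 0 1 \<Longrightarrow> F z = z * exp (K z)"
    using univalent_eq_times_exp[OF hol inj F0] by blast
  have "(F has_field_derivative exp (K 0)) (at 0)"
  proof (rule has_field_derivative_transform_within_open[where f = "\<lambda>z. z * exp (K z)" and S = "ball 0 1"])
    show "((\<lambda>z. z * exp (K z)) has_field_derivative exp (K 0)) (at 0)"
      using holomorphic_derivI[OF K open_ball, of 0] by (auto intro!: derivative_eq_intros)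
  qed (use FK in auto)
  then have "1 < cmod (exp (K 0))"
    using gt DERIV_imp_deriv by metis
  then obtain c where c: "1 < c" "c < cmod (exp (K 0))"
    using dense by blast
  have "isCont K 0"
    using holomorphic_on_imp_continuous_on[OF K] by (simp add: continuous_on_eq_continuous_at)
  then have "isCont (\<lambda>z. cmod (exp (K z))) 0"
    by (intro continuous_intros)
  then have "\<forall>\<^sub>F z in at 0. c < cmod (exp (K z))"
    using c by (simp add: isCont_def order_tendstoD)
  then obtain d where d: "d > 0" "\<And>z. z \<noteq> 0 \<Longrightarrow> cmod z < d \<Longrightarrow> c < cmod (exp (K z))"
    by (auto simp: eventually_at)
  \<comment> \<open>These choices give \<open>c \<rho> > 1\<close> and \<open>\<epsilon> < 1/c < \<rho> < 1\<close>.\<close>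
  define \<epsilon> where "\<epsilon> = min d (1 / c) / 2"
  define \<rho> where "\<rho> = (1 / c + 1) / 2"
  have \<epsilon>: "0 < \<epsilon>" "\<epsilon> < d" "\<epsilon> < 1 / c"
    using d c by (auto simp: \<epsilon>_def min_def field_simps)
  have \<rho>: "1 / c < \<rho>" "\<rho> < 1"
    using c by (auto simp: \<rho>_def field_simps)
  have \<epsilon>\<rho>: "\<epsilon> < \<rho>" "0 < \<rho>" using \<epsilon> \<rho> by linarith+
  have "\<epsilon> / \<rho> < c * \<epsilon>"
    using \<rho> \<epsilon>\<rho> \<epsilon> c by (simp add: field_simps)
  then obtain \<delta> where \<delta>: "\<epsilon> / \<rho> < \<delta>" "\<delta> < c * \<epsilon>"
    using dense by blast
  have \<delta>0: "0 < \<delta>" using \<delta>(1) \<epsilon>(1) \<epsilon>\<rho>(2) by (meson divide_pos_pos less_trans)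
  have inner: "ball 0 (c * \<epsilon>) \<subseteq> F ` ball 0 \<epsilon>"
  proof -
    have sub: "cball 0 \<epsilon> \<subseteq> ball (0 :: complex) 1" "ball 0 \<epsilon> \<subseteq> ball (0 :: complex) 1"
      using \<epsilon>\<rho> \<rho> by auto
    have "ball (F 0) (c * \<epsilon>) \<subseteq> F ` ball 0 \<epsilon>"
    proof (rule ball_subset_open_map_image)
      show "continuous_on (closure (ball 0 \<epsilon>)) F"
        using continuous_on_subset[OF holomorphic_on_imp_continuous_on[OF hol] sub(1)] \<epsilon>(1) by simp
      show "open (F ` interior (ball 0 \<epsilon>))"
        using open_mapping_thm3[OF holomorphic_on_subset[OF hol sub(2)] open_ball inj_on_subset[OF inj sub(2)]] by simp
      show "c * \<epsilon> \<le> cmod (F z - F 0)" if "z \<in> frontier (ball 0 \<epsilon>)" for z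
      proof -
        have z: "cmod z = \<epsilon>" using that \<epsilon>(1) by (simp add: frontier_def)
        then have "F z = z * exp (K z)" "c < cmod (exp (K z))"
          using FK[of z] d(2)[of z] \<epsilon> \<epsilon>\<rho> \<rho> by auto
        then show ?thesis
          using z \<epsilon>(1) F0 by (simp only: diff_zero norm_mult) (simp add: mult.commute)
      qed
    qed (use \<epsilon> c in auto)
    then show ?thesis using F0 by simp
  qed
  have "\<delta> \<le> \<epsilon> / \<rho>"
  proof (rule log_area_inequality[OF hol inj F0 prod \<epsilon>(1) \<epsilon>\<rho>(1) \<rho>(2) \<delta>0])
    fix z assume z: "\<epsilon> < cmod z" "cmod z < \<rho>"
    then have z1: "z \<in> ball 0 1" using \<rho>(2) by simp
    have "F z \<notin> F ` ball 0 \<epsilon>"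
      using z z1 inj_onD[OF inj _ z1] \<epsilon>\<rho> \<rho> by force
    then have 1: "c * \<epsilon> \<le> cmod (F z)"
      using inner by (auto simp: subset_iff not_less)
    then have Fz: "F z \<noteq> 0" using \<delta>0 \<delta>(2) by auto
    have "inverse (F z) \<notin> F ` ball 0 \<epsilon>"
    proof
      assume "inverse (F z) \<in> F ` ball 0 \<epsilon>"
      then obtain w where "w \<in> ball 0 \<epsilon>" "inverse (F z) = F w" by blast
      then show False
        using prod[OF z1, of w] Fz \<epsilon>\<rho> \<rho> by (force simp: field_simps)
    qed
    then have "inverse (F z) \<notin> ball 0 (c * \<epsilon>)"
      using inner by blast
    then have "c * \<epsilon> \<le> 1 / cmod (F z)"
      by (simp add: norm_inverse inverse_eq_divide norm_divide not_less)
    then have 2: "\<delta> < 1 / cmod (F z)" using \<delta>(2) by linarith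
    have "cmod (F z) < 1 / \<delta>"
      using 2 Fz \<delta>0 by (simp add: field_simps)
    then show "\<delta> < cmod (F z) \<and> cmod (F z) < 1 / \<delta>"
      using 1 \<delta>(2) by simp
  qed
  then show False using \<delta>(1) by simp
qed

text \<open>
  Koebe's square-root device: \<open>h = \<surd>(1 - g/\<zeta>)\<close> exists because \<open>g\<close> omits \<open>\<zeta>\<close>. If \<open>h\<close> took two
  opposite values, their squares would agree, so by injectivity of \<open>g\<close> both would be taken at one
  point, where \<open>h\<close> would vanish. The Moebius map \<open>w \<mapsto> (w - 1)/(w + 1)\<close> turns opposite values into
  reciprocal ones and \<open>h(0) = 1\<close> into \<open>0\<close>, and its derivative at \<open>1\<close> is \<open>1/2\<close>. Altogether
  \<open>|F'(0)| = |g'(0)| / (4 |\<zeta>|)\<close>.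
\<close>
lemma Koebe_unit_disc:
  assumes hol: "g holomorphic_on ball 0 1" and inj: "inj_on g (ball 0 1)" and g0: "g 0 = 0"
    and \<zeta>: "\<zeta> \<notin> g ` ball 0 1"
  shows "cmod (deriv g 0) \<le> 4 * cmod \<zeta>"
proof -
  let ?D = "ball 0 1 :: complex set"
  have \<zeta>0: "\<zeta> \<noteq> 0" using \<zeta> g0 by (metis centre_in_ball image_eqI zero_less_one)
  have nz: "1 - g z / \<zeta> \<noteq> 0" if "z \<in> ?D" for z
    using \<zeta> \<zeta>0 that by auto
  have hol': "(\<lambda>z. 1 - g z / \<zeta>) holomorphic_on ?D"
    using \<zeta>0 by (intro holomorphic_intros hol)
  obtain h0 where h0: "h0 holomorphic_on ?D" "\<And>z. z \<in> ?D \<Longrightarrow> 1 - g z / \<zeta> = (h0 z)\<^sup>2"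
    using contractible_imp_holomorphic_sqrt[OF hol' convex_imp_contractible[OF convex_ball] nz] by blast
  \<comment> \<open>Division by \<open>h0 0\<close>, which is \<open>1\<close> or \<open>-1\<close>, selects the root with value \<open>1\<close> at \<open>0\<close>.\<close>
  define h where "h = (\<lambda>z. h0 z / h0 0)"
  have "(h0 0)\<^sup>2 = 1" using h0(2)[of 0] g0 by simp
  then have h00: "h0 0 \<noteq> 0" and h2: "(h z)\<^sup>2 = 1 - g z / \<zeta>" if "z \<in> ?D" for z
    using h0(2) that by (auto simp: h_def power_divide)
  have h0_1: "h 0 = 1" using h00[of 0] by (simp add: h_def)
  have holh: "h holomorphic_on ?D"
    unfolding h_def using h00[of 0] by (intro holomorphic_intros h0(1)) auto
  have inj2: "z = w" if "z \<in> ?D" "w \<in> ?D" "(h z)\<^sup>2 = (h w)\<^sup>2" for z w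
    using inj_onD[OF inj _ that(1,2)] that h2 \<zeta>0 by simp
  have anti: "h z \<noteq> - h w" if "z \<in> ?D" "w \<in> ?D" for z w
  proof
    assume eq: "h z = - h w"
    then have "z = w" using inj2[OF that] by simp
    then have "h z = 0" using eq by simp
    then show False using h2[OF that(1)] nz[OF that(1)] by simp
  qed
  have hm1: "h z + 1 \<noteq> 0" if "z \<in> ?D" for z
    using anti[OF that, of 0] h0_1 by (auto simp: add_eq_0_iff2)
  define F where "F = (\<lambda>z. (h z - 1) / (h z + 1))"
  have holF: "F holomorphic_on ?D"
    unfolding F_def using hm1 by (intro holomorphic_intros holh) auto
  have "inj_on F ?D"
  proof (rule inj_onI)
    fix z w assume zw: "z \<in> ?D" "w \<in> ?D" "F z = F w"
    then have "(h z - 1) * (h w + 1) = (h w - 1) * (h z + 1)"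
      using hm1 by (simp add: F_def frac_eq_eq)
    then have "h z = h w" by (simp add: algebra_simps)
    then show "z = w" using inj2 zw by simp
  qed
  moreover have "F z * F w \<noteq> 1" if "z \<in> ?D" "w \<in> ?D" for z w
  proof
    assume "F z * F w = 1"
    then have "(h z - 1) * (h w - 1) = (h z + 1) * (h w + 1)"
      using hm1 that by (simp add: F_def)
    then have "2 * (h z + h w) = 0" by (simp add: algebra_simps)
    then have "h z + h w = 0" by (metis mult_eq_0_iff zero_neq_numeral)
    then have "h z = - h w" by (simp add: eq_neg_iff_add_eq_0)
    then show False using anti that by blast
  qed
  ultimately have "cmod (deriv F 0) \<le> 1"
    using holF h0_1 by (intro univalent_Bieberbach_Eilenberg) (auto simp: F_def)
  moreover have dh: "(h has_field_derivative deriv h 0) (at 0)"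
    using holomorphic_derivI[OF holh open_ball, of 0] by simp
  have "(F has_field_derivative deriv h 0 / 2) (at 0)"
    unfolding F_def using dh h0_1 by (auto intro!: derivative_eq_intros)
  then have "deriv F 0 = deriv h 0 / 2" by (rule DERIV_imp_deriv)
  moreover have "deriv g 0 = - 2 * \<zeta> * deriv h 0"
  proof (rule DERIV_imp_deriv)
    show "(g has_field_derivative - 2 * \<zeta> * deriv h 0) (at 0)"
    proof (rule has_field_derivative_transform_within_open[where S = ?D])
      show "((\<lambda>z. \<zeta> * (1 - (h z)\<^sup>2)) has_field_derivative - 2 * \<zeta> * deriv h 0) (at 0)"
        using dh h0_1 by (auto intro!: derivative_eq_intros)
      show "\<zeta> * (1 - (h z)\<^sup>2) = g z" if "z \<in> ?D" for z
        using h2[OF that] \<zeta>0 by simp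
    qed auto
  qed
  ultimately show ?thesis
    using mult_left_mono[of "cmod (deriv h 0)" 2 "cmod \<zeta>"] by (simp add: norm_mult norm_divide)
qed

theorem Koebe_quarter:
  assumes hol: "g holomorphic_on ball 0 r" and r: "0 < r" and inj: "inj_on g (ball 0 r)" and g0: "g 0 = 0"
    and \<zeta>: "\<zeta> \<notin> g ` ball 0 r"
  shows "r * cmod (deriv g 0) \<le> 4 * cmod \<zeta>"
proof -
  let ?G = "\<lambda>z. g (of_real r * z)"
  have img: "(*) (of_real r) ` ball 0 1 \<subseteq> (ball 0 r :: complex set)"
    using r by (auto simp: norm_mult)
  have "?G holomorphic_on ball 0 1"
    by (rule holomorphic_on_compose_gen[OF _ hol, unfolded o_def]) (use img in \<open>auto intro!: holomorphic_intros\<close>)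
  moreover have "inj_on ?G (ball 0 1)"
  proof (rule inj_onI)
    fix x y :: complex assume "x \<in> ball 0 1" "y \<in> ball 0 1" "?G x = ?G y"
    then have "of_real r * x = of_real r * y"
      using inj_onD[OF inj, of "of_real r * x" "of_real r * y"] img by blast
    then show "x = y" using r by simp
  qed
  moreover have "\<zeta> \<notin> ?G ` ball 0 1"
    using \<zeta> img by blast
  ultimately have "cmod (deriv ?G 0) \<le> 4 * cmod \<zeta>"
    using g0 by (intro Koebe_unit_disc) auto
  moreover have "deriv ?G 0 = deriv g 0 * of_real r"
  proof (rule DERIV_imp_deriv)
    have "(g has_field_derivative deriv g 0) (at (of_real r * 0))"
      using holomorphic_derivI[OF hol open_ball, of 0] r by simp
    from DERIV_chain[OF this DERIV_cmult_Id[of "of_real r" 0]]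
    show "(?G has_field_derivative deriv g 0 * of_real r) (at 0)"
      by (simp add: o_def)
  qed
  ultimately show ?thesis using r by (simp add: norm_mult mult.commute)
qed

text \<open>
  The Moebius map \<open>w \<mapsto> c w / (c + w)\<close> with \<open>c = t \<zeta>\<close> and large \<open>t > 0\<close> has its pole outside the
  bounded image of \<open>g\<close>. It has derivative \<open>1\<close> at its fixed point \<open>0\<close>, but moves the omitted value
  \<open>\<zeta>\<close> to \<open>t/(t + 1) \<zeta>\<close>, which is closer to \<open>0\<close>. The weak inequality for the composition is the
  strict one for \<open>g\<close>.
\<close>
theorem Koebe_quarter_strict:
  assumes hol: "g holomorphic_on ball 0 r" and r: "0 < r" and inj: "inj_on g (ball 0 r)" and g0: "g 0 = 0"
    and \<zeta>: "\<zeta> \<notin> g ` ball 0 r" and bdd: "bounded (g ` ball 0 r)"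
  shows "r * cmod (deriv g 0) < 4 * cmod \<zeta>"
proof -
  have \<zeta>0: "\<zeta> \<noteq> 0" using \<zeta> g0 r by (metis centre_in_ball image_eqI)
  obtain B where B: "B > 0" "\<And>z. z \<in> ball 0 r \<Longrightarrow> cmod (g z) < B"
    using bounded_pos_less[THEN iffD1, OF bdd] by auto
  define t where "t = B / cmod \<zeta> + 1"
  have t: "t > 0" "B < t * cmod \<zeta>"
    using B \<zeta>0 by (auto simp: t_def distrib_right intro: add_nonneg_pos)
  let ?c = "of_real t * \<zeta>"
  have c0: "?c \<noteq> 0" using t \<zeta>0 by simp
  have nz: "?c + g z \<noteq> 0" if "z \<in> ball 0 r" for z
  proof
    assume "?c + g z = 0"
    then have "cmod (g z) = cmod ?c" by (metis add_eq_0_iff norm_minus_cancel)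
    then show False using B(2)[OF that] t by (simp add: norm_mult)
  qed
  define G where "G = (\<lambda>z. ?c * g z / (?c + g z))"
  have G: "G holomorphic_on ball 0 r"
    unfolding G_def using nz by (intro holomorphic_intros hol) auto
  have inv: "a = b" if "?c * a / (?c + a) = ?c * b / (?c + b)" "?c + a \<noteq> 0" "?c + b \<noteq> 0" for a b
  proof -
    have "?c * a * (?c + b) = ?c * b * (?c + a)" using that by (simp add: frac_eq_eq)
    then have "?c * ?c * (a - b) = 0" by (simp add: algebra_simps)
    then show ?thesis using c0 by simp
  qed
  have "inj_on G (ball 0 r)"
    using inv nz inj unfolding G_def inj_on_def by blast
  moreover have c\<zeta>: "?c + \<zeta> \<noteq> 0"
  proof -
    have "?c + \<zeta> = of_real (t + 1) * \<zeta>" by (simp add: algebra_simps)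
    then show ?thesis using t \<zeta>0 by (simp del: of_real_add)
  qed
  moreover have "?c * \<zeta> / (?c + \<zeta>) \<notin> G ` ball 0 r"
    using inv nz \<zeta> c\<zeta> unfolding G_def by blast
  ultimately have "r * cmod (deriv G 0) \<le> 4 * cmod (?c * \<zeta> / (?c + \<zeta>))"
    using G r g0 by (intro Koebe_quarter) (auto simp: G_def)
  moreover have "deriv G 0 = deriv g 0"
  proof (rule DERIV_imp_deriv)
    have "(g has_field_derivative deriv g 0) (at 0)"
      using holomorphic_derivI[OF hol open_ball, of 0] r by simp
    then show "(G has_field_derivative deriv g 0) (at 0)"
      unfolding G_def using c0 g0 by (auto intro!: derivative_eq_intros simp: field_simps)
  qed
  moreover have "cmod (?c * \<zeta> / (?c + \<zeta>)) < cmod \<zeta>"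
  proof -
    have "?c * \<zeta> / (?c + \<zeta>) = of_real (t / (t + 1)) * \<zeta>"
    proof -
      have "?c + \<zeta> = of_real (t + 1) * \<zeta>" by (simp add: algebra_simps)
      then show ?thesis using \<zeta>0 by (simp add: divide_simps)
    qed
    then have "cmod (?c * \<zeta> / (?c + \<zeta>)) = t / (t + 1) * cmod \<zeta>"
      using t by (simp add: norm_mult del: of_real_divide of_real_add)
    moreover have "t / (t + 1) * cmod \<zeta> < 1 * cmod \<zeta>"
      using t \<zeta>0 by (intro mult_strict_right_mono) auto
    ultimately show ?thesis by linarith
  qed
  ultimately show ?thesis by simp
qed
section \<open>Branches of the inverse of a holomorphic map\<close>

definition holomorphic_section :: "complex set \<Rightarrow> (complex \<Rightarrow> complex) \<Rightarrow> complex set \<Rightarrow> (complex \<Rightarrow> complex) \<Rightarrow> bool" where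
  "holomorphic_section U \<phi> V g \<longleftrightarrow> g holomorphic_on V \<and> (\<forall>w\<in>V. g w \<in> U \<and> \<phi> (g w) = w)"

lemma holomorphic_section_subset:
  "holomorphic_section U \<phi> V g \<Longrightarrow> W \<subseteq> V \<Longrightarrow> holomorphic_section U \<phi> W g"
  unfolding holomorphic_section_def using holomorphic_on_subset by blast

lemma holomorphic_section_inj: "holomorphic_section U \<phi> V g \<Longrightarrow> inj_on g V"
  unfolding holomorphic_section_def by (metis inj_onI)

lemma holomorphic_section_deriv:
  assumes U: "open U" "\<phi> holomorphic_on U" and V: "open V" and g: "holomorphic_section U \<phi> V g" and w: "w \<in> V"
  shows "deriv \<phi> (g w) * deriv g w = 1"
proof -
  have "(\<phi> has_field_derivative deriv \<phi> (g w)) (at (g w))"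
    using U g w by (auto simp: holomorphic_section_def intro: holomorphic_derivI)
  moreover have "(g has_field_derivative deriv g w) (at w)"
    using V g w by (auto simp: holomorphic_section_def intro: holomorphic_derivI)
  ultimately have "((\<lambda>w. \<phi> (g w)) has_field_derivative deriv \<phi> (g w) * deriv g w) (at w)"
    by (rule DERIV_chain2)
  then have "((\<lambda>w. w) has_field_derivative deriv \<phi> (g w) * deriv g w) (at w)"
    by (rule has_field_derivative_transform_within_open[OF _ V w]) (use g in \<open>auto simp: holomorphic_section_def\<close>)
  then show ?thesis
    using DERIV_unique DERIV_ident by blast
qed

lemma local_holomorphic_section:
  assumes U: "open U" "\<phi> holomorphic_on U" and z: "z \<in> U" "deriv \<phi> z \<noteq> 0"
  obtains N \<epsilon> h where "open N" "z \<in> N" "inj_on \<phi> N" "\<epsilon> > 0" "h ` ball (\<phi> z) \<epsilon> \<subseteq> N"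
    "h (\<phi> z) = z" "holomorphic_section U \<phi> (ball (\<phi> z) \<epsilon>) h"
proof -
  obtain r where r: "r > 0" "ball z r \<subseteq> U" "open (\<phi> ` ball z r)" "inj_on \<phi> (ball z r)"
    using has_complex_derivative_locally_invertible[OF U(2) z(1) U(1) z(2)] by blast
  obtain h where h: "h holomorphic_on \<phi> ` ball z r" "\<And>x. x \<in> ball z r \<Longrightarrow> h (\<phi> x) = x"
    using holomorphic_has_inverse[OF holomorphic_on_subset[OF U(2) r(2)] open_ball r(4)] by metis
  obtain \<epsilon> where \<epsilon>: "\<epsilon> > 0" "ball (\<phi> z) \<epsilon> \<subseteq> \<phi> ` ball z r"
    using r(1,3) by (metis centre_in_ball imageI openE)
  have "h ` ball (\<phi> z) \<epsilon> \<subseteq> ball z r"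
    using \<epsilon>(2) h(2) by force
  moreover have "holomorphic_section U \<phi> (ball (\<phi> z) \<epsilon>) h"
    unfolding holomorphic_section_def
  proof (intro conjI ballI)
    show "h holomorphic_on ball (\<phi> z) \<epsilon>" using h(1) \<epsilon>(2) by (rule holomorphic_on_subset)
  qed (use \<epsilon>(2) h(2) r(2) in force)+
  ultimately show ?thesis
    using that[of "ball z r" \<epsilon> h] r \<epsilon> h(2)[of z] by simp
qed

text \<open>
  Near a common value the map \<open>\<phi>\<close> is injective, so the two sections agree near \<open>b\<close>; the identity
  theorem does the rest.
\<close>
lemma holomorphic_section_unique:
  assumes U: "open U" "\<phi> holomorphic_on U" and V: "open V" "connected V"
    and f: "holomorphic_section U \<phi> V f" and g: "holomorphic_section U \<phi> V g"
    and b: "b \<in> V" "f b = g b" and w: "w \<in> V"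
  shows "f w = g w"
proof -
  have z: "f b \<in> U" "deriv \<phi> (f b) \<noteq> 0"
    using f b holomorphic_section_deriv[OF U V(1) f b(1)] by (auto simp: holomorphic_section_def)
  obtain N where N: "open N" "f b \<in> N" "inj_on \<phi> N"
    using local_holomorphic_section[OF U z] by metis
  have cont: "continuous_on V f" "continuous_on V g"
    using f g by (auto simp: holomorphic_section_def intro: holomorphic_on_imp_continuous_on)
  let ?W = "(V \<inter> f -` N) \<inter> (V \<inter> g -` N)"
  have "open ?W"
    using continuous_open_preimage[OF cont(1) V(1) N(1)] continuous_open_preimage[OF cont(2) V(1) N(1)] by blast
  moreover have "?W \<noteq> {}" using b N by auto
  moreover have "f v = g v" if "v \<in> ?W" for v
    using that f g inj_onD[OF N(3), of "f v" "g v"] by (auto simp: holomorphic_section_def)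
  ultimately show ?thesis
    using f g V w by (intro analytic_continuation_open[of ?W V f g w]) (auto simp: holomorphic_section_def)
qed

lemma glue_holomorphic_sections:
  assumes sec: "\<And>i. i \<in> I \<Longrightarrow> open (V i) \<and> holomorphic_section U \<phi> (V i) (g i)"
    and agree: "\<And>i j w. i \<in> I \<Longrightarrow> j \<in> I \<Longrightarrow> w \<in> V i \<Longrightarrow> w \<in> V j \<Longrightarrow> g i w = g j w"
  obtains G where "holomorphic_section U \<phi> (\<Union>i\<in>I. V i) G" "\<And>i w. i \<in> I \<Longrightarrow> w \<in> V i \<Longrightarrow> G w = g i w"
proof -
  define G where "G = (\<lambda>w. g (SOME i. i \<in> I \<and> w \<in> V i) w)"
  have G: "G w = g i w" if "i \<in> I" "w \<in> V i" for i w
    unfolding G_def using someI[of "\<lambda>i. i \<in> I \<and> w \<in> V i" i] that agree by blast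
  have "G holomorphic_on V i" if "i \<in> I" for i
    using sec[OF that] G[OF that] holomorphic_transform by (metis holomorphic_section_def)
  then have "G holomorphic_on (\<Union>i\<in>I. V i)"
    using sec by (intro holomorphic_on_UN_open) auto
  then have "holomorphic_section U \<phi> (\<Union>i\<in>I. V i) G"
    using sec G by (auto simp: holomorphic_section_def)
  with G that show ?thesis by blast
qed

text \<open>
  Along a sequence converging to \<open>w\<close> from inside the disc, the values of \<open>g\<close> stay in a compact set,
  so they accumulate at some \<open>z\<close> with \<open>\<phi>(z) = w\<close>. The local inverse of \<open>\<phi>\<close> at \<open>z\<close> agrees with \<open>g\<close> at
  a point of this sequence, hence on the whole convex overlap of the two discs.
\<close>
lemma section_extends_at_boundary_point:
  assumes U: "open U" "\<phi> holomorphic_on U"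
    and r: "0 < r" and compact: "compact {z \<in> U. cmod (\<phi> z) \<le> r}"
    and regular: "\<And>z. z \<in> U \<Longrightarrow> cmod (\<phi> z) = r \<Longrightarrow> deriv \<phi> z \<noteq> 0"
    and g: "holomorphic_section U \<phi> (ball 0 r) g" and w: "cmod w = r"
  obtains \<epsilon> h where "\<epsilon> > 0" "holomorphic_section U \<phi> (ball w \<epsilon>) h"
    "\<And>v. v \<in> ball w \<epsilon> \<inter> ball 0 r \<Longrightarrow> h v = g v"
proof -
  let ?C = "{z \<in> U. cmod (\<phi> z) \<le> r}"
  have "w \<in> closure (ball 0 r)" using w r by simp
  then obtain s where s: "\<And>n. s n \<in> ball 0 r" "s \<longlonglongrightarrow> w"
    unfolding closure_sequential by blast
  have gs: "g (s n) \<in> U \<and> \<phi> (g (s n)) = s n" for n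
    using g s(1) by (auto simp: holomorphic_section_def)
  have "g (s n) \<in> ?C" for n
    using gs[of n] s(1)[of n] by auto
  then obtain z \<sigma> where z: "z \<in> ?C" "strict_mono \<sigma>" "((\<lambda>n. g (s n)) \<circ> \<sigma>) \<longlonglongrightarrow> z"
    using compact unfolding compact_def by (metis (no_types, lifting))
  then have zU: "z \<in> U" by simp
  have lim: "(\<lambda>n. g (s (\<sigma> n))) \<longlonglongrightarrow> z" "(\<lambda>n. s (\<sigma> n)) \<longlonglongrightarrow> w"
    using z(3) LIMSEQ_subseq_LIMSEQ[OF s(2) z(2)] by (simp_all add: o_def)
  have "isCont \<phi> z"
    using U zU holomorphic_on_imp_continuous_on continuous_on_eq_continuous_at by blast
  from isCont_tendsto_compose[OF this lim(1)]
  have "(\<lambda>n. s (\<sigma> n)) \<longlonglongrightarrow> \<phi> z" using gs by simp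
  with lim(2) have \<phi>z: "\<phi> z = w" using LIMSEQ_unique by blast
  have dz: "deriv \<phi> z \<noteq> 0" using regular[OF zU] \<phi>z w by simp
  obtain N \<epsilon> h where N: "open N" "z \<in> N" "inj_on \<phi> N" and \<epsilon>: "\<epsilon> > 0" and hN: "h ` ball w \<epsilon> \<subseteq> N"
    and h: "holomorphic_section U \<phi> (ball w \<epsilon>) h"
    using local_holomorphic_section[OF U zU dz] \<phi>z by metis
  have "\<forall>\<^sub>F n in sequentially. g (s (\<sigma> n)) \<in> N \<and> s (\<sigma> n) \<in> ball w \<epsilon>"
    using topological_tendstoD[OF lim(1) N(1,2)] topological_tendstoD[OF lim(2) open_ball, of w \<epsilon>] \<epsilon>
    by (intro eventually_conj) auto
  then obtain n where n: "g (s (\<sigma> n)) \<in> N" "s (\<sigma> n) \<in> ball w \<epsilon>"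
    using eventually_happens'[OF sequentially_bot] by blast
  have "h (s (\<sigma> n)) = g (s (\<sigma> n))"
  proof (rule inj_onD[OF N(3)])
    show "\<phi> (h (s (\<sigma> n))) = \<phi> (g (s (\<sigma> n)))"
      using h n(2) gs by (simp add: holomorphic_section_def)
  qed (use n hN in auto)
  then have "h v = g v" if "v \<in> ball w \<epsilon> \<inter> ball 0 r" for v
  proof (intro holomorphic_section_unique[OF U _ _ _ _ _ _ that])
    show "connected (ball w \<epsilon> \<inter> ball 0 r)" by (intro convex_connected convex_Int convex_ball)
    show "holomorphic_section U \<phi> (ball w \<epsilon> \<inter> ball 0 r) h" using h by (rule holomorphic_section_subset) auto
    show "holomorphic_section U \<phi> (ball w \<epsilon> \<inter> ball 0 r) g" using g by (rule holomorphic_section_subset) auto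
    show "s (\<sigma> n) \<in> ball w \<epsilon> \<inter> ball 0 r" using n s by blast
  qed auto
  with \<epsilon> h that show ?thesis by blast
qed

text \<open>
  The continuations across the boundary points agree with one another: the intersection of two
  balls centred on the circle, if not empty, meets the disc, where both continuations are \<open>g\<close>. So
  they can be glued together with \<open>g\<close>, and by compactness of the closed disc the union of all these
  balls contains a larger disc.
\<close>
lemma section_extends_to_larger_ball:
  assumes U: "open U" "\<phi> holomorphic_on U"
    and r: "0 < r" and compact: "compact {z \<in> U. cmod (\<phi> z) \<le> r}"
    and regular: "\<And>z. z \<in> U \<Longrightarrow> cmod (\<phi> z) = r \<Longrightarrow> deriv \<phi> z \<noteq> 0"
    and g: "holomorphic_section U \<phi> (ball 0 r) g"
  obtains r' G where "r < r'" "holomorphic_section U \<phi> (ball 0 r') G" "G 0 = g 0"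
proof -
  have "\<exists>\<epsilon> h. \<epsilon> > 0 \<and> holomorphic_section U \<phi> (ball w \<epsilon>) h \<and> (\<forall>v \<in> ball w \<epsilon> \<inter> ball 0 r. h v = g v)"
    if "w \<in> sphere 0 r" for w
    using section_extends_at_boundary_point[OF assms, of w] that by (metis mem_sphere_0)
  then obtain e h where e: "\<And>w. w \<in> sphere 0 r \<Longrightarrow> e w > (0 :: real)"
    and h: "\<And>w. w \<in> sphere 0 r \<Longrightarrow> holomorphic_section U \<phi> (ball w (e w)) (h w)"
    and hg: "\<And>w v. w \<in> sphere 0 r \<Longrightarrow> v \<in> ball w (e w) \<Longrightarrow> v \<in> ball 0 r \<Longrightarrow> h w v = g v"
    by (metis IntI)
  have hh: "h w v = h w' v" if ww: "w \<in> sphere 0 r" "w' \<in> sphere 0 r"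
    and v: "v \<in> ball w (e w)" "v \<in> ball w' (e w')" for w w' v
  proof -
    let ?C = "ball w (e w) \<inter> ball w' (e w')"
    \<comment> \<open>Projection to the disc does not increase distances and fixes both centres, so it stays in both balls.\<close>
    define p where "p = closest_point (cball 0 r) v"
    have p: "p \<in> cball 0 r"
      unfolding p_def using r by (intro closest_point_in_set) auto
    have "dist u p \<le> dist u v" if "u \<in> sphere 0 r" for u
    proof -
      have "closest_point (cball 0 r) u = u" using that by (intro closest_point_self) auto
      then show ?thesis
        using closest_point_lipschitz[of "cball 0 r" u v] r by (simp add: p_def)
    qed
    then have "p \<in> ?C" using ww v by (fastforce simp: dist_commute)
    then have "?C \<inter> closure (ball 0 r) \<noteq> {}" using p r by auto
    then have "?C \<inter> ball 0 r \<noteq> {}"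
      using open_Int_closure_eq_empty[of ?C "ball 0 r"] by (metis open_Int open_ball)
    then obtain u where u: "u \<in> ?C" "u \<in> ball 0 r" by blast
    show ?thesis
    proof (rule holomorphic_section_unique[OF U, where V = ?C and b = u and w = v and f = "h w" and g = "h w'"])
      show "connected ?C" by (intro convex_connected convex_Int convex_ball)
      show "holomorphic_section U \<phi> ?C (h w)" using h[OF ww(1)] by (rule holomorphic_section_subset) auto
      show "holomorphic_section U \<phi> ?C (h w')" using h[OF ww(2)] by (rule holomorphic_section_subset) auto
      show "u \<in> ?C" "v \<in> ?C" using u v by auto
      show "h w u = h w' u" using u hg ww by auto
    qed auto
  qed
  \<comment> \<open>The index \<open>0\<close>, which is not on the circle, stands for the disc itself.\<close>
  define V where "V = (\<lambda>w. if w = 0 then ball 0 r else ball w (e w))"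
  define k where "k = (\<lambda>w. if w = 0 then g else h w)"
  have nz: "w \<noteq> 0" if "w \<in> sphere 0 r" for w using that r by auto
  obtain G where G: "holomorphic_section U \<phi> (\<Union>w \<in> insert 0 (sphere 0 r). V w) G"
    and Gk: "\<And>w v. w \<in> insert 0 (sphere 0 r) \<Longrightarrow> v \<in> V w \<Longrightarrow> G v = k w v"
  proof (rule glue_holomorphic_sections)
    show "open (V w) \<and> holomorphic_section U \<phi> (V w) (k w)" if "w \<in> insert 0 (sphere 0 r)" for w
      using that g h nz by (auto simp: V_def k_def)
    show "k w v = k w' v" if "w \<in> insert 0 (sphere 0 r)" "w' \<in> insert 0 (sphere 0 r)" "v \<in> V w" "v \<in> V w'" for w w' v
      using that hh[of w w' v] hg[of w v] hg[of w' v] unfolding V_def k_def by (auto split: if_splits)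
  qed blast
  let ?O = "\<Union>w \<in> insert 0 (sphere 0 r). V w"
  have "cball 0 r \<subseteq> ?O"
  proof
    fix v :: complex assume v: "v \<in> cball 0 r"
    show "v \<in> ?O"
    proof (cases "cmod v = r")
      case True
      then have "v \<in> sphere 0 r" by simp
      then have "v \<in> V v" using nz[of v] e[of v] by (simp add: V_def)
      with \<open>v \<in> sphere 0 r\<close> show ?thesis by blast
    next
      case False
      then have "v \<in> V 0" using v by (simp add: V_def)
      then show ?thesis by blast
    qed
  qed
  moreover have "open ?O" by (auto simp: V_def)
  ultimately obtain d where d: "d > 0" "(\<Union>x\<in>cball 0 r. ball x d) \<subseteq> ?O"
    using compact_subset_open_imp_ball_epsilon_subset[OF compact_cball] by blast
  have "ball 0 (r + d) \<subseteq> ?O"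
  proof
    fix v :: complex assume v: "v \<in> ball 0 (r + d)"
    have "v \<in> (\<Union>x\<in>cball 0 r. ball x d)"
    proof (cases "cmod v \<le> r")
      case True
      then show ?thesis using d(1) by (intro UN_I[of v]) auto
    next
      case False
      let ?x = "of_real (r / cmod v) * v"
      have "v - ?x = of_real (1 - r / cmod v) * v" by (simp add: algebra_simps)
      then have "dist v ?x = \<bar>1 - r / cmod v\<bar> * cmod v"
        by (simp only: dist_norm norm_mult norm_of_real)
      also have "\<bar>1 - r / cmod v\<bar> = 1 - r / cmod v" using False r less_trans[of 0 r "cmod v"] by simp
      also have "(1 - r / cmod v) * cmod v = cmod v - r" using False r by (auto simp: left_diff_distrib)
      finally have "v \<in> ball ?x d" using v by (simp add: dist_commute)
      moreover have "?x \<in> cball 0 r" using False r by (auto simp: norm_mult norm_divide)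
      ultimately show ?thesis by blast
    qed
    then show "v \<in> ?O" using d(2) by blast
  qed
  then have "holomorphic_section U \<phi> (ball 0 (r + d)) G"
    using G holomorphic_section_subset by blast
  moreover have "G 0 = g 0"
    using Gk[of 0 0] r by (simp add: V_def k_def)
  ultimately show ?thesis using that d(1) by (meson less_add_same_cancel1)
qed

text \<open>
  Let \<open>r\<close> be the supremum of the radii of discs around \<open>0\<close> on which \<open>\<phi>\<close> has a section that fixes
  \<open>0\<close>. The sections on different discs are restrictions of one section \<open>G\<close> on their union.

  If \<open>r\<close> is infinite, \<open>G\<close> cannot omit a value, because Koebe's theorem bounds the product of
  \<open>|G'(0)|\<close> and the radius of each disc. Thus \<open>G\<close> is a bijection of the plane, with inverse \<open>\<phi>\<close>.
  If \<open>r\<close> is finite, \<open>G\<close> does not extend to a larger disc, so some critical point has a value of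
  modulus \<open>r\<close>. This point is omitted by \<open>G\<close>, because \<open>|\<phi>| < r\<close> on the image of \<open>G\<close>.
\<close>
theorem critical_point_at_most_quarter:
  assumes U: "open U" "\<phi> holomorphic_on U" and 0: "0 \<in> U" "\<phi> 0 = 0" "deriv \<phi> 0 \<noteq> 0"
    and proper: "\<And>r. compact {z \<in> U. cmod (\<phi> z) \<le> r}"
    and not_bij: "\<not> (U = UNIV \<and> inj \<phi>)"
  obtains \<zeta> where "\<zeta> \<in> U" "deriv \<phi> \<zeta> = 0" "\<phi> \<zeta> \<noteq> 0" "cmod (\<phi> \<zeta>) < 4 * cmod \<zeta> * cmod (deriv \<phi> 0)"
proof -
  define S where "S = {r. 0 < r \<and> (\<exists>g. holomorphic_section U \<phi> (ball 0 r) g \<and> g 0 = 0)}"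
  have "\<exists>g. \<forall>r\<in>S. holomorphic_section U \<phi> (ball 0 r) (g r) \<and> g r 0 = 0"
    unfolding S_def by (intro bchoice) auto
  then obtain g where g: "\<And>r. r \<in> S \<Longrightarrow> holomorphic_section U \<phi> (ball 0 r) (g r)" "\<And>r. r \<in> S \<Longrightarrow> g r 0 = 0"
    by blast
  have agree: "g r w = g r' w" if "r \<in> S" "r' \<in> S" "w \<in> ball 0 r" "w \<in> ball 0 r'" for r r' w
  proof (rule holomorphic_section_unique[OF U, where V = "ball 0 (min r r')" and b = 0 and w = w and f = "g r" and g = "g r'"])
    show "holomorphic_section U \<phi> (ball 0 (min r r')) (g r)" "holomorphic_section U \<phi> (ball 0 (min r r')) (g r')"
      using holomorphic_section_subset[OF g(1)[OF that(1)], of "ball 0 (min r r')"]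
        holomorphic_section_subset[OF g(1)[OF that(2)], of "ball 0 (min r r')"] by (auto simp: subset_ball)
  qed (use that g(2) in \<open>auto simp: S_def\<close>)
  obtain G where G: "holomorphic_section U \<phi> (\<Union>r\<in>S. ball 0 r) G" "\<And>r w. r \<in> S \<Longrightarrow> w \<in> ball 0 r \<Longrightarrow> G w = g r w"
  proof (rule glue_holomorphic_sections)
    show "open (ball 0 r) \<and> holomorphic_section U \<phi> (ball 0 r) (g r)" if "r \<in> S" for r
      using g(1)[OF that] by simp
    show "g r w = g r' w" if "r \<in> S" "r' \<in> S" "w \<in> ball 0 r" "w \<in> ball 0 r'" for r r' w
      using agree[OF that] .
  qed blast
  obtain r1 where r1: "r1 \<in> S"
  proof -
    obtain \<epsilon> h where "\<epsilon> > 0" "h (\<phi> 0) = 0" "holomorphic_section U \<phi> (ball (\<phi> 0) \<epsilon>) h"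
      using local_holomorphic_section[OF U 0(1,3)] by metis
    then show ?thesis using that[of \<epsilon>] 0(2) by (auto simp: S_def)
  qed
  have G0: "G 0 = 0" using G(2)[OF r1, of 0] g(2)[OF r1] r1 by (simp add: S_def)
  have inv: "deriv \<phi> 0 * deriv G 0 = 1"
  proof -
    have "0 \<in> (\<Union>r\<in>S. ball (0 :: complex) r)"
      using r1 by (intro UN_I[OF r1]) (simp add: S_def)
    then show ?thesis
      using holomorphic_section_deriv[OF U open_UN G(1), of 0] G0 by simp
  qed
  show ?thesis
  proof (cases "bdd_above S")
    case True
    define r where "r = Sup S"
    have union: "(\<Union>r\<in>S. ball 0 r) = (ball 0 r :: complex set)"
    proof
      show "(\<Union>r\<in>S. ball 0 r) \<subseteq> (ball 0 r :: complex set)"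
        using cSup_upper[OF _ True] unfolding r_def by (intro UN_least subset_ball) blast
      show "ball 0 r \<subseteq> (\<Union>r\<in>S. ball (0 :: complex) r)"
      proof
        fix w :: complex assume "w \<in> ball 0 r"
        then have "cmod w < Sup S" by (simp add: r_def)
        then obtain r' where "r' \<in> S" "cmod w < r'"
          using less_cSupE[of "cmod w" S] r1 by blast
        then show "w \<in> (\<Union>r\<in>S. ball (0 :: complex) r)" by auto
      qed
    qed
    have r: "0 < r" using cSup_upper[OF r1 True] r1 by (simp add: r_def S_def)
    have sec: "holomorphic_section U \<phi> (ball 0 r) G" using G(1) union by simp
    have "\<exists>\<zeta>\<in>U. cmod (\<phi> \<zeta>) = r \<and> deriv \<phi> \<zeta> = 0"
    proof (rule ccontr)
      assume "\<not> ?thesis"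
      then obtain r' G' where "r < r'" "holomorphic_section U \<phi> (ball 0 r') G'" "G' 0 = G 0"
        using section_extends_to_larger_ball[OF U r proper _ sec] by blast
      then have "r' \<in> S" using G0 r by (auto simp: S_def)
      then show False using cSup_upper[OF _ True] \<open>r < r'\<close> by (force simp: r_def)
    qed
    then obtain \<zeta> where \<zeta>: "\<zeta> \<in> U" "cmod (\<phi> \<zeta>) = r" "deriv \<phi> \<zeta> = 0" by blast
    have "r * cmod (deriv G 0) < 4 * cmod \<zeta>"
    proof (rule Koebe_quarter_strict[OF _ r holomorphic_section_inj[OF sec] G0])
      show "G holomorphic_on ball 0 r" using sec by (simp add: holomorphic_section_def)
      show "\<zeta> \<notin> G ` ball 0 r" using sec \<zeta>(2) by (auto simp: holomorphic_section_def)
      have "G ` ball 0 r \<subseteq> {z \<in> U. cmod (\<phi> z) \<le> r}"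
        using sec by (auto simp: holomorphic_section_def)
      then show "bounded (G ` ball 0 r)"
        by (rule bounded_subset[OF compact_imp_bounded[OF proper]])
    qed
    moreover have "cmod (deriv \<phi> 0) * cmod (deriv G 0) = 1"
      using inv by (metis norm_mult norm_one)
    moreover have "r * (cmod (deriv \<phi> 0) * cmod (deriv G 0)) < 4 * cmod \<zeta> * cmod (deriv \<phi> 0)"
      using mult_strict_right_mono[OF calculation(1), of "cmod (deriv \<phi> 0)"] 0(3) by (simp add: ac_simps)
    moreover have "\<phi> \<zeta> \<noteq> 0" using \<zeta>(2) r by auto
    ultimately show ?thesis
      using that[of \<zeta>] \<zeta> by simp
  next
    case False
    have union: "(\<Union>r\<in>S. ball 0 r) = (UNIV :: complex set)"
    proof -
      have "\<exists>r\<in>S. cmod z < r" for z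
        using False unfolding bdd_above_def by (meson not_le)
      then show ?thesis by auto
    qed
    then have sec: "holomorphic_section U \<phi> UNIV G" using G(1) by simp
    have "range G = UNIV"
    proof (rule ccontr)
      assume "range G \<noteq> UNIV"
      then obtain \<zeta> where \<zeta>: "\<zeta> \<notin> range G" by blast
      have bound: "r * cmod (deriv G 0) \<le> 4 * cmod \<zeta>" if "r > 0" for r
      proof (rule Koebe_quarter)
        have "holomorphic_section U \<phi> (ball 0 r) G"
          using sec by (rule holomorphic_section_subset) simp
        then show "G holomorphic_on ball 0 r" "inj_on G (ball 0 r)"
          using holomorphic_section_inj by (simp_all add: holomorphic_section_def)
        show "\<zeta> \<notin> G ` ball 0 r" using \<zeta> by blast
        show "0 < r" "G 0 = 0" by fact+
      qed
      have "cmod (deriv G 0) > 0" using inv by auto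
      moreover have "4 * cmod \<zeta> + 1 > 0" by (simp add: add_nonneg_pos)
      ultimately show False
        using bound[of "(4 * cmod \<zeta> + 1) / cmod (deriv G 0)"] by simp
    qed
    have \<phi>G: "G w \<in> U" "\<phi> (G w) = w" for w
      using sec by (simp_all add: holomorphic_section_def)
    have "z \<in> U" "G (\<phi> z) = z" for z
    proof -
      obtain w where "z = G w" using \<open>range G = UNIV\<close> by blast
      then show "z \<in> U" "G (\<phi> z) = z" using \<phi>G by simp_all
    qed
    then have "U = UNIV" "inj \<phi>" by (blast, metis injI)
    then show ?thesis using not_bij by blast
  qed
qed
section \<open>Derivatives of maps of the Riemann sphere\<close>

definition sphere_chart :: "riemann_sphere \<Rightarrow> riemann_sphere set" where
  "sphere_chart b = (if b = None then - {Some 0} else - {None})"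

text \<open>
  A bare derivative in coordinates says nothing about whether \<open>f\<close> maps a neighbourhood of \<open>a\<close> into the
  coordinate domain at \<open>f a\<close>, because the coordinate is totalized by the value \<open>0\<close>. With this
  condition included, the notion implies continuity at \<open>a\<close> and obeys the chain rule.
\<close>
definition has_sphere_deriv :: "(riemann_sphere \<Rightarrow> riemann_sphere) \<Rightarrow> complex \<Rightarrow> riemann_sphere \<Rightarrow> bool" where
  "has_sphere_deriv f D a \<longleftrightarrow>
     (\<forall>\<^sub>F z in nhds (sphere_coord a a). f (sphere_coord_inv a z) \<in> sphere_chart (f a)) \<and>
     ((\<lambda>z. sphere_coord (f a) (f (sphere_coord_inv a z))) has_field_derivative D) (at (sphere_coord a a))"

lemma sphere_coord_inv_centre [simp]: "sphere_coord_inv a (sphere_coord a a) = a"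
  by (simp add: sphere_coord_def sphere_coord_inv_def split: option.splits)

lemma sphere_coord_inv_coord: "w \<in> sphere_chart b \<Longrightarrow> sphere_coord_inv b (sphere_coord b w) = w"
  by (auto simp: sphere_chart_def sphere_coord_def sphere_coord_inv_def split: option.splits if_splits)

lemma local_deriv_eq: "has_sphere_deriv f D a \<Longrightarrow> local_deriv a (f a) f = D"
  by (simp add: has_sphere_deriv_def local_deriv_def DERIV_imp_deriv)

lemma has_sphere_deriv_unique: "has_sphere_deriv f D a \<Longrightarrow> has_sphere_deriv f E a \<Longrightarrow> D = E"
  using local_deriv_eq by metis

lemma has_sphere_deriv_id: "has_sphere_deriv id 1 a"
proof -
  have "\<forall>\<^sub>F z in nhds (sphere_coord a a). sphere_coord_inv a z \<in> sphere_chart a"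
    by (auto simp: sphere_chart_def sphere_coord_inv_def)
  moreover have "sphere_coord a (sphere_coord_inv a z) = z" for z
    by (auto simp: sphere_coord_def sphere_coord_inv_def)
  ultimately show ?thesis
    by (simp add: has_sphere_deriv_def)
qed

lemma has_sphere_deriv_comp:
  assumes f: "has_sphere_deriv f D a" and g: "has_sphere_deriv g E (f a)"
  shows "has_sphere_deriv (g \<circ> f) (E * D) a"
proof -
  let ?F = "\<lambda>z. sphere_coord (f a) (f (sphere_coord_inv a z))"
  let ?G = "\<lambda>u. sphere_coord (g (f a)) (g (sphere_coord_inv (f a) u))"
  let ?z = "sphere_coord a a"
  have F: "(?F has_field_derivative D) (at ?z)" and ev: "\<forall>\<^sub>F z in nhds ?z. f (sphere_coord_inv a z) \<in> sphere_chart (f a)"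
    using f by (auto simp: has_sphere_deriv_def)
  have G: "(?G has_field_derivative E) (at (?F ?z))" and evG: "\<forall>\<^sub>F u in nhds (?F ?z). g (sphere_coord_inv (f a) u) \<in> sphere_chart (g (f a))"
    using g by (simp_all add: has_sphere_deriv_def)
  have "(?F \<longlongrightarrow> ?F ?z) (nhds ?z)"
    using DERIV_isCont[OF F] tendsto_at_iff_tendsto_nhds[of ?F ?z] by (simp add: isCont_def)
  then have evF: "\<forall>\<^sub>F z in nhds ?z. g (sphere_coord_inv (f a) (?F z)) \<in> sphere_chart (g (f a))"
    by (rule eventually_compose_filterlim[OF evG])
  have inv: "\<forall>\<^sub>F z in nhds ?z. sphere_coord_inv (f a) (?F z) = f (sphere_coord_inv a z)"
    using ev by eventually_elim (rule sphere_coord_inv_coord)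
  have "\<forall>\<^sub>F z in nhds ?z. (g \<circ> f) (sphere_coord_inv a z) \<in> sphere_chart ((g \<circ> f) a)"
    using evF inv by eventually_elim simp
  moreover have "((\<lambda>z. sphere_coord ((g \<circ> f) a) ((g \<circ> f) (sphere_coord_inv a z))) has_field_derivative E * D) (at ?z)"
  proof (rule iffD1[OF DERIV_cong_ev[OF refl _ refl] DERIV_chain2[OF G F]])
    show "\<forall>\<^sub>F z in nhds ?z. ?G (?F z) = sphere_coord ((g \<circ> f) a) ((g \<circ> f) (sphere_coord_inv a z))"
      using inv by eventually_elim simp
  qed
  ultimately show ?thesis
    by (simp add: has_sphere_deriv_def)
qed


section \<open>Rational maps\<close>

text \<open>
  Near a zero of the denominator the coordinate \<open>1/w\<close> of the value is \<open>Q/P\<close>, elsewhere the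
  coordinate is \<open>P/Q\<close> itself.
\<close>
lemma fraction_has_sphere_chart_deriv:
  assumes P: "(P has_field_derivative P') (at z)" and Q: "(Q has_field_derivative Q') (at z)"
    and nz: "P z \<noteq> 0 \<or> Q z \<noteq> 0"
    and \<phi>: "\<And>u. \<phi> u = (if Q u = 0 then None else Some (P u / Q u))"
  shows "\<exists>D. (\<forall>\<^sub>F u in nhds z. \<phi> u \<in> sphere_chart (\<phi> z)) \<and>
            ((\<lambda>u. sphere_coord (\<phi> z) (\<phi> u)) has_field_derivative D) (at z)"
proof -
  have nonzero: "\<forall>\<^sub>F u in nhds z. h u \<noteq> 0" if "(h has_field_derivative h') (at z)" "h z \<noteq> 0" for h h'
  proof -
    have "(h \<longlongrightarrow> h z) (nhds z)"
      using DERIV_isCont[OF that(1)] tendsto_at_iff_tendsto_nhds[of h z] by (simp add: isCont_def)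
    then show ?thesis by (rule tendsto_imp_eventually_ne) fact
  qed
  show ?thesis
  proof (cases "Q z = 0")
    case True
    then have Pz: "P z \<noteq> 0" using nz by simp
    have "\<forall>\<^sub>F u in nhds z. \<phi> u \<in> sphere_chart (\<phi> z)"
      using nonzero[OF P Pz] by eventually_elim (simp add: \<phi> True sphere_chart_def)
    moreover have "sphere_coord (\<phi> z) (\<phi> u) = Q u / P u" for u
      by (simp add: \<phi> True sphere_coord_def)
    ultimately show ?thesis
      using DERIV_divide[OF Q P Pz] by auto
  next
    case False
    have ev: "\<forall>\<^sub>F u in nhds z. Q u \<noteq> 0"
      by (rule nonzero[OF Q False])
    have "\<forall>\<^sub>F u in nhds z. \<phi> u \<in> sphere_chart (\<phi> z)"
      using ev by eventually_elim (simp add: \<phi> False sphere_chart_def)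
    moreover have "\<forall>\<^sub>F u in nhds z. P u / Q u = sphere_coord (\<phi> z) (\<phi> u)"
      using ev by eventually_elim (simp add: \<phi> False sphere_coord_def)
    note iffD1[OF DERIV_cong_ev[OF refl this refl] DERIV_divide[OF P Q False]]
    ultimately show ?thesis
      by blast
  qed
qed

text \<open>
  At infinity one substitutes \<open>1/u\<close> and multiplies numerator and denominator by \<open>u ^ n\<close>. This yields
  reflected polynomials whose values at \<open>u = 0\<close> are the coefficients of index \<open>n\<close>. At least one of
  these is not zero, since \<open>n\<close> is the larger one of the two degrees.
\<close>
lemma sphere_map_of_fract_has_sphere_deriv:
  assumes nz: "\<And>z. poly p z \<noteq> 0 \<or> poly q z \<noteq> 0"
  shows "\<exists>D. has_sphere_deriv (sphere_map_of_fract p q) D a"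
proof (cases a)
  case (Some z)
  show ?thesis
    using fraction_has_sphere_chart_deriv[OF poly_DERIV poly_DERIV nz, of "\<lambda>u. sphere_map_of_fract p q (Some u)" z]
    by (simp add: has_sphere_deriv_def Some sphere_coord_def sphere_coord_inv_def)
next
  case None
  define n where "n = max (degree p) (degree q)"
  let ?r = "\<lambda>s u. u ^ (n - degree s) * poly (reflect_poly s) u"
  have r0: "?r s 0 = coeff s n" if "degree s \<le> n" for s :: "complex poly"
    using that by (cases "degree s = n") (auto simp: coeff_eq_0 poly_0_coeff_0 coeff_0_reflect_poly)
  have r: "?r s u = u ^ n * poly s (inverse u)" if "degree s \<le> n" "u \<noteq> 0" for s :: "complex poly" and u
    using that by (simp add: poly_reflect_poly_nz flip: power_add mult.assoc)
  have rp: "?r p 0 = coeff p n" and rq: "?r q 0 = coeff q n"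
    by (rule r0, simp add: n_def)+
  have nz0: "?r p 0 \<noteq> 0 \<or> ?r q 0 \<noteq> 0"
  proof (rule ccontr)
    assume "\<not> ?thesis"
    then have "coeff p n = 0" "coeff q n = 0" unfolding rp rq by blast+
    then have "p = 0 \<and> q = 0"
    proof (cases "degree p \<le> degree q")
      case True
      then have "n = degree q" by (simp add: n_def)
      then have "q = 0" using \<open>coeff q n = 0\<close> leading_coeff_0_iff[of q] by simp
      then have "n = degree p" using \<open>n = degree q\<close> True by simp
      then show ?thesis using \<open>q = 0\<close> \<open>coeff p n = 0\<close> leading_coeff_0_iff[of p] by simp
    next
      case False
      then have "n = degree p" by (simp add: n_def)
      then have "p = 0" using \<open>coeff p n = 0\<close> leading_coeff_0_iff[of p] by simp
      then show ?thesis using False by simp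
    qed
    then show False using nz by auto
  qed
  have R: "sphere_map_of_fract p q (sphere_coord_inv None u) = (if ?r q u = 0 then None else Some (?r p u / ?r q u))" for u
  proof (cases "u = 0")
    case True
    then show ?thesis
      unfolding True rp rq by (simp add: sphere_coord_inv_def n_def[symmetric])
  next
    case False
    then show ?thesis
      unfolding r[of p, OF _ False, unfolded n_def, simplified, folded n_def] r[of q, OF _ False, unfolded n_def, simplified, folded n_def]
      using False by (simp add: sphere_coord_inv_def)
  qed
  have der: "\<exists>D. (?r s has_field_derivative D) (at 0)" for s :: "complex poly"
    unfolding field_differentiable_def[symmetric]
    by (intro derivative_intros) (metis poly_DERIV field_differentiable_def)
  from der[of p] der[of q] obtain P' Q' where "(?r p has_field_derivative P') (at 0)" "(?r q has_field_derivative Q') (at 0)"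
    by blast
  note deriv = fraction_has_sphere_chart_deriv[OF this nz0 R]
  have "sphere_coord None None = 0" "sphere_coord_inv None 0 = None"
    by (simp_all add: sphere_coord_def sphere_coord_inv_def)
  with deriv show ?thesis
    by (simp only: has_sphere_deriv_def None)
qed

lemma rational_map_has_sphere_deriv:
  assumes "rational_map_of_degree n R"
  shows "\<exists>D. has_sphere_deriv R D a"
proof -
  obtain p q where pq: "coprime p q" "R = sphere_map_of_fract p q"
    using assms by (auto simp: rational_map_of_degree_def)
  then show ?thesis
    using sphere_map_of_fract_has_sphere_deriv[of p q a] coprime_poly_0[OF pq(1)] by simp
qed

text \<open>
  Suppose \<open>R = p/q\<close> is injective. For all \<open>w\<close> but at most one, \<open>p - w q\<close> has degree \<open>n \<ge> 2\<close>, and all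
  its roots are preimages of \<open>w\<close>, so it has a single root, which is multiple and therefore a zero of
  \<open>p' q - p q'\<close>. Different \<open>w\<close> have different roots; so this polynomial has infinitely many zeros and
  vanishes. By coprimality \<open>p\<close> divides \<open>p'\<close> and \<open>q\<close> divides \<open>q'\<close>, which makes both constant.
\<close>
lemma rational_map_not_inj:
  assumes "rational_map_of_degree n R" "n \<ge> 2"
  shows "\<not> inj R"
proof
  assume inj: "inj R"
  obtain p q where cop: "coprime p q" and n: "n = max (degree p) (degree q)" and R: "R = sphere_map_of_fract p q"
    using assms by (auto simp: rational_map_of_degree_def)
  define W where "W = {w. coeff p n - w * coeff q n \<noteq> 0}"
  have ncoeff: "coeff p n \<noteq> 0 \<or> coeff q n \<noteq> 0"
    using assms(2) n by (metis leading_coeff_0_iff degree_0 max_def not_numeral_le_zero)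
  have "infinite W"
  proof
    assume "finite W"
    moreover have "finite (- W)"
    proof (rule finite_subset)
      show "- W \<subseteq> {coeff p n / coeff q n}" using ncoeff by (auto simp: W_def field_simps)
    qed simp
    ultimately have "finite (UNIV :: complex set)" by (metis Compl_partition finite_Un)
    then show False using infinite_UNIV_char_0 by blast
  qed
  have "\<exists>a. R (Some a) = Some w \<and> poly (pderiv p * q - p * pderiv q) a = 0" if "w \<in> W" for w
  proof -
    let ?P = "p - smult w q"
    have "degree ?P \<le> n" unfolding n by (metis degree_diff_le degree_smult_le max.cobounded1 max.coboundedI2)
    moreover have "coeff ?P n \<noteq> 0" using that by (simp add: W_def)
    ultimately have deg: "degree ?P = n" using le_degree by (metis le_antisym)
    have root: "R (Some z) = Some w" if "poly ?P z = 0" for z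
    proof -
      have "poly q z \<noteq> 0" using that coprime_poly_0[OF cop, of z] by auto
      then show ?thesis using that by (simp add: R)
    qed
    obtain a where a: "poly ?P a = 0"
      using fundamental_theorem_of_algebra_alt[of ?P] deg assms(2) by (metis degree_pCons_0 not_numeral_le_zero)
    obtain Q where Q: "?P = [:- a, 1:] * Q"
      using a by (metis poly_eq_0_iff_dvd dvdE)
    have "Q \<noteq> 0" using Q deg assms(2) by auto
    then have "degree Q \<ge> 1"
      using deg assms(2) degree_mult_eq[of "[:- a, 1:]" Q] unfolding Q by simp
    then obtain b where b: "poly Q b = 0"
      using fundamental_theorem_of_algebra_alt[of Q] by (metis degree_pCons_0 not_one_le_zero)
    then have "poly ?P b = 0" by (simp add: Q)
    then have "R (Some b) = R (Some a)" using root[OF a] root[of b] by simp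
    then have "b = a" using injD[OF inj] by blast
    then have "poly (pderiv ?P) a = 0"
      using b unfolding Q pderiv_mult by simp
    then have "poly (pderiv p) a = w * poly (pderiv q) a" "poly p a = w * poly q a"
      using a by (simp_all add: pderiv_diff pderiv_smult)
    then show ?thesis using root[OF a] by auto
  qed
  then obtain a where a: "\<And>w. w \<in> W \<Longrightarrow> R (Some (a w)) = Some w"
    "\<And>w. w \<in> W \<Longrightarrow> poly (pderiv p * q - p * pderiv q) (a w) = 0"
    by metis
  have "inj_on a W" using a(1) by (metis inj_onI option.inject)
  then have "infinite (a ` W)" using \<open>infinite W\<close> finite_imageD by blast
  then have "infinite {z. poly (pderiv p * q - p * pderiv q) z = 0}"
    using a(2) by (metis (mono_tags, lifting) finite_subset image_subsetI mem_Collect_eq)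
  then have eq: "pderiv p * q = p * pderiv q"
    using poly_roots_finite[of "pderiv p * q - p * pderiv q"] by (metis eq_iff_diff_eq_0)
  have const: "degree s = 0" if "s dvd pderiv s" for s :: "complex poly"
  proof (rule ccontr)
    assume "degree s \<noteq> 0"
    moreover from this have "pderiv s \<noteq> 0" by (simp add: pderiv_eq_0_iff)
    ultimately show False
      using dvd_imp_degree_le[OF that] degree_pderiv[of s] by simp
  qed
  have "q dvd pderiv q"
  proof -
    have "q dvd p * pderiv q" unfolding eq[symmetric] by (rule dvd_triv_right)
    then show ?thesis
      using coprime_dvd_mult_right_iff[OF cop[THEN iffD2[OF coprime_commute]]] by blast
  qed
  moreover have "p dvd pderiv p"
  proof -
    have "p dvd pderiv p * q" unfolding eq by (rule dvd_triv_left)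
    then show ?thesis using coprime_dvd_mult_left_iff[OF cop] by blast
  qed
  ultimately show False using const n assms(2) by simp
qed
section \<open>Critical points of sphere maps that fix zero and infinity\<close>

lemma eventually_outside_disc_near_pole:
  assumes f: "has_sphere_deriv f D a" and pole: "f a = None"
  shows "\<forall>\<^sub>F z in nhds (sphere_coord a a). \<forall>w. f (sphere_coord_inv a z) = Some w \<longrightarrow> r < cmod w"
proof -
  let ?F = "\<lambda>z. sphere_coord None (f (sphere_coord_inv a z))"
  have ev: "\<forall>\<^sub>F z in nhds (sphere_coord a a). f (sphere_coord_inv a z) \<noteq> Some 0"
    and F: "(?F has_field_derivative D) (at (sphere_coord a a))"
    using f pole by (simp_all add: has_sphere_deriv_def sphere_chart_def)
  have "(?F \<longlongrightarrow> ?F (sphere_coord a a)) (nhds (sphere_coord a a))"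
    using DERIV_isCont[OF F] tendsto_at_iff_tendsto_nhds[of ?F "sphere_coord a a"] by (simp add: isCont_def)
  moreover have "?F (sphere_coord a a) = 0"
    using pole by (simp add: sphere_coord_def[of None])
  ultimately have "(?F \<longlongrightarrow> 0) (nhds (sphere_coord a a))" by (simp only:)
  then have "\<forall>\<^sub>F z in nhds (sphere_coord a a). dist (?F z) 0 < 1 / (\<bar>r\<bar> + 1)"
    by (rule tendstoD) simp
  with ev show ?thesis
  proof eventually_elim
    case (elim z)
    show ?case
    proof (intro allI impI)
      fix w assume w: "f (sphere_coord_inv a z) = Some w"
      then have "w \<noteq> 0" "1 / cmod w < 1 / (\<bar>r\<bar> + 1)"
        using elim by (auto simp: sphere_coord_def norm_inverse divide_inverse)
      then have "\<bar>r\<bar> + 1 < cmod w" by (simp add: field_simps)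
      then show "r < cmod w" by simp
    qed
  qed
qed

text \<open>
  The finite part of \<open>f\<close>, as a function on the set \<open>U\<close> of finite points with finite value,
  satisfies the hypotheses of \<open>critical_point_at_most_quarter\<close>. Its sublevel sets are bounded because
  \<open>f\<close> maps \<open>\<infinity>\<close> to \<open>\<infinity>\<close>, and closed in the plane because \<open>|f|\<close> is large near poles.
\<close>
theorem critical_point_quarter_normalized:
  assumes hol: "\<And>a. \<exists>D. has_sphere_deriv f D a"
    and f0: "f (Some 0) = Some 0" and finf: "f None = None" and ninj: "\<not> inj f"
    and ncrit: "has_sphere_deriv f d (Some 0)" "d \<noteq> 0"
  obtains \<zeta> v where "f (Some \<zeta>) = Some v" "v \<noteq> 0" "has_sphere_deriv f 0 (Some \<zeta>)"
    "cmod v < 4 * cmod \<zeta> * cmod d"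
proof -
  define U where "U = {z. f (Some z) \<noteq> None}"
  define \<phi> where "\<phi> = (\<lambda>z. sphere_coord (Some 0) (f (Some z)))"
  have f\<phi>: "f (Some z) = Some (\<phi> z)" if "z \<in> U" for z
    using that by (auto simp: U_def \<phi>_def sphere_coord_def)
  have coord: "sphere_coord (Some w) = sphere_coord (Some 0)" for w
    by (rule ext) (simp add: sphere_coord_def split: option.split)
  have at_finite: "has_sphere_deriv f D (Some z) \<longleftrightarrow>
      (\<forall>\<^sub>F u in nhds z. u \<in> U) \<and> (\<phi> has_field_derivative D) (at z)" if "z \<in> U" for z D
  proof -
    have "sphere_coord (Some z) (Some z) = z" "sphere_coord_inv (Some z) u = Some u" for u
      by (simp_all add: sphere_coord_def sphere_coord_inv_def)
    then show ?thesis
      unfolding has_sphere_deriv_def f\<phi>[OF that] coord[of "\<phi> z"]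
      by (simp add: sphere_chart_def U_def \<phi>_def)
  qed
  have evU: "\<forall>\<^sub>F u in nhds z. u \<in> U" and derU: "\<exists>D. (\<phi> has_field_derivative D) (at z)" if "z \<in> U" for z
    using hol[of "Some z"] at_finite[OF that] by blast+
  have openI: "open S" if "\<And>z. z \<in> S \<Longrightarrow> \<forall>\<^sub>F u in nhds z. u \<in> S" for S :: "complex set"
    unfolding open_subopen[of S]
  proof
    fix z assume "z \<in> S"
    from that[OF this] show "\<exists>T. open T \<and> z \<in> T \<and> T \<subseteq> S"
      by (auto simp: eventually_nhds)
  qed
  have U: "open U"
    using evU by (rule openI)
  have \<phi>: "\<phi> holomorphic_on U"
    using derU holomorphic_on_open[OF U] by blast
  have crit_iff: "has_sphere_deriv f (deriv \<phi> z) (Some z)" if "z \<in> U" for z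
    using at_finite[OF that] evU[OF that] holomorphic_derivI[OF \<phi> U that] by blast
  have zero: "0 \<in> U" "\<phi> 0 = 0"
    using f0 by (simp_all add: U_def \<phi>_def sphere_coord_def)
  have d: "deriv \<phi> 0 = d"
    using has_sphere_deriv_unique[OF crit_iff[OF zero(1)] ncrit(1)] .
  have proper: "compact {z \<in> U. cmod (\<phi> z) \<le> r}" (is "compact ?K") for r
  proof -
    have "\<forall>\<^sub>F u in nhds z. u \<in> - ?K" if "z \<in> - ?K" for z
    proof (cases "z \<in> U")
      case True
      then have "r < cmod (\<phi> z)" using that by simp
      moreover obtain D where D: "(\<phi> has_field_derivative D) (at z)" using derU[OF True] by blast
      have "(\<phi> \<longlongrightarrow> \<phi> z) (nhds z)"
        using DERIV_isCont[OF D] tendsto_at_iff_tendsto_nhds[of \<phi> z] by (simp add: isCont_def)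
      ultimately have "\<forall>\<^sub>F u in nhds z. r < cmod (\<phi> u)"
        using order_tendstoD(1)[OF tendsto_norm] by blast
      then show ?thesis by eventually_elim simp
    next
      case False
      then have pole: "f (Some z) = None" by (simp add: U_def)
      obtain D where "has_sphere_deriv f D (Some z)" using hol by blast
      from eventually_outside_disc_near_pole[OF this pole, of r]
      have "\<forall>\<^sub>F u in nhds z. \<forall>w. f (Some u) = Some w \<longrightarrow> r < cmod w"
        by (simp add: sphere_coord_def sphere_coord_inv_def)
      then show ?thesis
      proof eventually_elim
        case (elim u)
        then show ?case using f\<phi>[of u] by (auto simp: not_le)
      qed
    qed
    then have "open (- ?K)"
      by (rule openI)
    then have "closed ?K" by (simp add: closed_def)
    moreover have "bounded ?K"
    proof -
      obtain D where "has_sphere_deriv f D None" using hol by blast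
      from eventually_outside_disc_near_pole[OF this finf, of r]
      have "\<forall>\<^sub>F u in nhds 0. \<forall>w. f (sphere_coord_inv None u) = Some w \<longrightarrow> r < cmod w"
        by (simp add: sphere_coord_def)
      then obtain e where e: "e > 0" "\<And>u w. cmod u < e \<Longrightarrow> f (sphere_coord_inv None u) = Some w \<Longrightarrow> r < cmod w"
        by (auto simp: eventually_nhds_metric)
      have "cmod z \<le> 1 / e" if "z \<in> ?K" for z
      proof (rule ccontr)
        assume z: "\<not> cmod z \<le> 1 / e"
        then have "z \<noteq> 0" using e(1) by auto
        then have "cmod (inverse z) < e"
          unfolding norm_inverse using z e(1) by (simp add: field_simps)
        moreover have "f (sphere_coord_inv None (inverse z)) = Some (\<phi> z)"
          using f\<phi>[of z] that \<open>z \<noteq> 0\<close> by (simp add: sphere_coord_inv_def)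
        ultimately show False using e(2) that by fastforce
      qed
      then show ?thesis by (intro boundedI)
    qed
    ultimately show ?thesis by (simp add: compact_eq_bounded_closed)
  qed
  have "\<not> (U = UNIV \<and> inj \<phi>)"
  proof
    assume bij: "U = UNIV \<and> inj \<phi>"
    have "inj f"
    proof (rule injI)
      fix a b assume "f a = f b"
      then show "a = b"
        using bij f\<phi> finf by (cases a; cases b) (auto dest: injD)
    qed
    with ninj show False by blast
  qed
  then obtain \<zeta> where \<zeta>: "\<zeta> \<in> U" "deriv \<phi> \<zeta> = 0" "\<phi> \<zeta> \<noteq> 0" "cmod (\<phi> \<zeta>) < 4 * cmod \<zeta> * cmod (deriv \<phi> 0)"
    using critical_point_at_most_quarter[OF U \<phi> zero _ proper] d ncrit(2) by blast
  then show ?thesis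
    using that[of \<zeta> "\<phi> \<zeta>"] f\<phi> crit_iff[OF \<zeta>(1)] d by simp
qed


section \<open>Moebius maps\<close>

definition moebius_of :: "complex \<Rightarrow> complex \<Rightarrow> complex \<Rightarrow> complex \<Rightarrow> riemann_sphere \<Rightarrow> riemann_sphere" where
  "moebius_of a b c d = sphere_map_of_fract [:b, a:] [:d, c:]"

text \<open>
  The point with homogeneous coordinates \<open>[u : v]\<close>. In these coordinates Moebius maps are linear, and
  composition is matrix multiplication without a case distinction at infinity.
\<close>
definition sphere_ratio :: "complex \<Rightarrow> complex \<Rightarrow> riemann_sphere" where
  "sphere_ratio u v = (if v = 0 then None else Some (u / v))"

lemma sphere_ratio_cases:
  obtains u v where "x = sphere_ratio u v" "u \<noteq> 0 \<or> v \<noteq> 0"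
  by (cases x) (metis sphere_ratio_def zero_neq_one, metis div_by_1 sphere_ratio_def zero_neq_one)

lemma sphere_ratio_eq_iff:
  assumes "u \<noteq> 0 \<or> v \<noteq> 0" "u' \<noteq> 0 \<or> v' \<noteq> 0"
  shows "sphere_ratio u v = sphere_ratio u' v' \<longleftrightarrow> u * v' = u' * v"
  using assms by (auto simp: sphere_ratio_def frac_eq_eq)

lemma sphere_ratio_mult: "t \<noteq> 0 \<Longrightarrow> sphere_ratio (t * u) (t * v) = sphere_ratio u v"
  by (simp add: sphere_ratio_def)

lemma moebius_of_None: "a * d - b * c \<noteq> 0 \<Longrightarrow> moebius_of a b c d None = sphere_ratio a c"
  by (cases "c = 0") (auto simp: moebius_of_def sphere_ratio_def max_def)

lemma moebius_of_Some: "moebius_of a b c d (Some z) = sphere_ratio (a * z + b) (c * z + d)"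
  by (simp add: moebius_of_def sphere_ratio_def algebra_simps)

lemma moebius_of_sphere_ratio:
  assumes det: "a * d - b * c \<noteq> 0" and uv: "u \<noteq> 0 \<or> v \<noteq> 0"
  shows "moebius_of a b c d (sphere_ratio u v) = sphere_ratio (a * u + b * v) (c * u + d * v)"
proof (cases "v = 0")
  case True
  then show ?thesis
    using uv moebius_of_None[OF det] sphere_ratio_mult[of u a c] by (simp add: sphere_ratio_def mult.commute)
next
  case False
  have "moebius_of a b c d (sphere_ratio u v) = sphere_ratio (a * (u / v) + b) (c * (u / v) + d)"
    using False by (simp add: sphere_ratio_def[of u v] moebius_of_Some)
  also have "\<dots> = sphere_ratio (v * (a * (u / v) + b)) (v * (c * (u / v) + d))"
    by (rule sphere_ratio_mult[OF False, symmetric])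
  also have "v * (a * (u / v) + b) = a * u + b * v"
    using False by (simp add: distrib_left)
  also have "v * (c * (u / v) + d) = c * u + d * v"
    using False by (simp add: distrib_left)
  finally show ?thesis .
qed

lemma moebius_map_iff: "moebius_map M \<longleftrightarrow> (\<exists>a b c d. a * d - b * c \<noteq> 0 \<and> M = moebius_of a b c d)"
proof -
  have "M = moebius_of a b c d \<longleftrightarrow>
      (\<forall>z. M (Some z) = (if c * z + d = 0 then None else Some (moebius a b c d z))) \<and>
      M None = (if c = 0 then None else Some (a / c))" if det: "a * d - b * c \<noteq> 0" for a b c d
    unfolding fun_eq_iff split_option_all moebius_of_None[OF det] moebius_of_Some
    by (auto simp: sphere_ratio_def moebius_def)
  then show ?thesis unfolding moebius_map_def by blast
qed

lemma moebius_map_comp: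
  assumes "moebius_map M" "moebius_map N"
  shows "moebius_map (M \<circ> N)"
proof -
  obtain a b c d where M: "a * d - b * c \<noteq> 0" "M = moebius_of a b c d"
    using assms moebius_map_iff by blast
  obtain a' b' c' d' where N: "a' * d' - b' * c' \<noteq> 0" "N = moebius_of a' b' c' d'"
    using assms moebius_map_iff by blast
  let ?A = "a * a' + b * c'" and ?B = "a * b' + b * d'" and ?C = "c * a' + d * c'" and ?D = "c * b' + d * d'"
  have "?A * ?D - ?B * ?C = (a * d - b * c) * (a' * d' - b' * c')"
    by (simp add: algebra_simps)
  then have det: "?A * ?D - ?B * ?C \<noteq> 0" using M N by simp
  have "(M \<circ> N) x = moebius_of ?A ?B ?C ?D x" for x
  proof -
    obtain u v where x: "x = sphere_ratio u v" and uv: "u \<noteq> 0 \<or> v \<noteq> 0" using sphere_ratio_cases .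
    have "a' * u + b' * v \<noteq> 0 \<or> c' * u + d' * v \<noteq> 0"
    proof (rule ccontr)
      assume "\<not> ?thesis"
      then have "a' * u + b' * v = 0" "c' * u + d' * v = 0" by auto
      then have "(a' * d' - b' * c') * u = 0" "(a' * d' - b' * c') * v = 0" by algebra+
      then show False using N(1) uv by simp
    qed
    then show ?thesis
      unfolding x M(2) N(2) comp_apply moebius_of_sphere_ratio[OF N(1) uv] moebius_of_sphere_ratio[OF det uv]
      using moebius_of_sphere_ratio[OF M(1)] by (simp add: algebra_simps)
  qed
  then show ?thesis unfolding moebius_map_iff using det by blast
qed

text \<open>
  The adjugate matrix inverts the given one up to the factor \<open>a d - b c\<close>, which homogeneous
  coordinates do not see.
\<close>
lemma moebius_map_left_inverse:
  assumes "moebius_map M"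
  obtains N where "moebius_map N" "N \<circ> M = id"
proof -
  obtain a b c d where M: "a * d - b * c \<noteq> 0" "M = moebius_of a b c d"
    using assms moebius_map_iff by blast
  have det: "d * a - (- b) * (- c) \<noteq> 0" using M by (simp add: mult.commute)
  have "moebius_of d (- b) (- c) a (M x) = x" for x
  proof -
    obtain u v where x: "x = sphere_ratio u v" and uv: "u \<noteq> 0 \<or> v \<noteq> 0" using sphere_ratio_cases .
    have uv': "a * u + b * v \<noteq> 0 \<or> c * u + d * v \<noteq> 0"
    proof (rule ccontr)
      assume "\<not> ?thesis"
      then have "a * u + b * v = 0" "c * u + d * v = 0" by auto
      then have "(a * d - b * c) * u = 0" "(a * d - b * c) * v = 0" by algebra+
      then show False using M(1) uv by simp
    qed
    have "moebius_of d (- b) (- c) a (M x) = sphere_ratio ((a * d - b * c) * u) ((a * d - b * c) * v)"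
      unfolding x M(2) moebius_of_sphere_ratio[OF M(1) uv] moebius_of_sphere_ratio[OF det uv'] by (simp add: algebra_simps)
    then show ?thesis using sphere_ratio_mult[OF M(1)] x by simp
  qed
  then have "moebius_of d (- b) (- c) a \<circ> M = id" by auto
  moreover have "moebius_map (moebius_of d (- b) (- c) a)" using det moebius_map_iff by blast
  ultimately show ?thesis using that by blast
qed

lemma moebius_map_inverse:
  assumes M: "moebius_map M"
  obtains N where "moebius_map N" "N \<circ> M = id" "M \<circ> N = id"
proof -
  obtain N where N: "moebius_map N" "N \<circ> M = id" using moebius_map_left_inverse[OF M] .
  obtain P where P: "P \<circ> N = id" using moebius_map_left_inverse[OF N(1)] by metis
  have "P = M" using N(2) P by (metis comp_assoc comp_id id_comp)
  with that N P show ?thesis by blast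
qed

text \<open>
  The columns of the matrix are homogeneous coordinates of the images of \<open>\<infinity>\<close> and \<open>0\<close>; its
  determinant does not vanish exactly because these points differ.
\<close>
lemma moebius_map_two_points:
  assumes "x \<noteq> y"
  obtains M where "moebius_map M" "M (Some 0) = x" "M None = y"
proof -
  obtain b d where x: "x = sphere_ratio b d" "b \<noteq> 0 \<or> d \<noteq> 0" using sphere_ratio_cases .
  obtain a c where y: "y = sphere_ratio a c" "a \<noteq> 0 \<or> c \<noteq> 0" using sphere_ratio_cases .
  have det: "a * d - b * c \<noteq> 0"
    using assms sphere_ratio_eq_iff[OF x(2) y(2)] by (auto simp: x y)
  show ?thesis
    using that[of "moebius_of a b c d"] det moebius_of_None[OF det] moebius_map_iff x y by (auto simp: moebius_of_Some)
qed

text \<open>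
  The derivative does not vanish because, by the chain rule, its product with the derivative of the
  inverse map is \<open>1\<close>.
\<close>
lemma moebius_map_has_sphere_deriv:
  assumes M: "moebius_map M"
  obtains D where "has_sphere_deriv M D a" "D \<noteq> 0"
proof -
  have ex: "\<exists>D. has_sphere_deriv N D x" if N: "moebius_map N" for N x
  proof -
    obtain a b c d where N': "a * d - b * c \<noteq> 0" "N = moebius_of a b c d"
      using N moebius_map_iff by blast
    have "poly [:b, a:] z \<noteq> 0 \<or> poly [:d, c:] z \<noteq> 0" for z
    proof (rule ccontr)
      assume "\<not> ?thesis"
      then have "b + z * a = 0" "d + z * c = 0" by auto
      then have "a * d - b * c = 0" by algebra
      then show False using N'(1) by simp
    qed
    then show ?thesis unfolding N'(2) moebius_of_def by (rule sphere_map_of_fract_has_sphere_deriv)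
  qed
  obtain N where N: "moebius_map N" "N \<circ> M = id" using moebius_map_left_inverse[OF M] .
  obtain D E where D: "has_sphere_deriv M D a" and E: "has_sphere_deriv N E (M a)"
    using ex M N(1) by blast
  have "E * D = 1"
    using has_sphere_deriv_unique[OF has_sphere_deriv_comp[OF D E]] N(2) has_sphere_deriv_id by metis
  then have "D \<noteq> 0" by auto
  with D show ?thesis by (rule that)
qed

lemma moebius_of_scale:
  assumes "s \<noteq> 0"
  shows "moebius_map (moebius_of s 0 0 1)" "moebius_of s 0 0 1 (Some z) = Some (s * z)" "moebius_of s 0 0 1 None = None"
    "has_sphere_deriv (moebius_of s 0 0 1) s (Some 0)"
proof -
  show *: "moebius_of s 0 0 1 (Some z) = Some (s * z)" for z
    by (simp add: moebius_of_Some sphere_ratio_def)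
  show "moebius_of s 0 0 1 None = None" using assms by (simp add: moebius_of_None sphere_ratio_def)
  show "moebius_map (moebius_of s 0 0 1)" unfolding moebius_map_iff using assms by (metis diff_zero mult.right_neutral mult_zero_left)
  show "has_sphere_deriv (moebius_of s 0 0 1) s (Some 0)"
    by (simp add: has_sphere_deriv_def sphere_chart_def sphere_coord_def sphere_coord_inv_def * DERIV_cmult_Id)
qed


section \<open>Fixing two points and a critical point\<close>

theorem theorem1:
  fixes R :: "riemann_sphere \<Rightarrow> riemann_sphere" and x y :: riemann_sphere and n :: nat
  assumes "rational_map_of_degree n R" and "n \<ge> 2"
    and "R x \<noteq> R y"
    and "\<not> critical_point R x"
  shows "\<exists>\<zeta> M. critical_point R \<zeta> \<and> moebius_map M \<and>
           (M \<circ> R) x = x \<and> (M \<circ> R) y = y \<and> (M \<circ> R) \<zeta> = \<zeta> \<and>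
           cmod (multiplier (M \<circ> R) x) > 1 / 4"
proof -
  obtain A where A: "moebius_map A" "A (Some 0) = x" "A None = y"
    using moebius_map_two_points[of x y] assms(3) by metis
  obtain B' where B': "moebius_map B'" "B' (Some 0) = R x" "B' None = R y"
    using moebius_map_two_points[OF assms(3)] .
  obtain B where B: "moebius_map B" "B \<circ> B' = id" "B' \<circ> B = id" using moebius_map_inverse[OF B'(1)] .
  obtain A' where A': "A' \<circ> A = id" "A \<circ> A' = id" using moebius_map_inverse[OF A(1)] by metis
  define f where "f = B \<circ> (R \<circ> A)"
  have BB': "B (B' w) = w" for w using B(2) by (metis comp_apply id_apply)
  have Bx: "B (R x) = Some 0" and By: "B (R y) = None"
    using BB' B'(2,3) by metis+
  have chain: "has_sphere_deriv f (dB * (dR * dA)) a"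
    if "has_sphere_deriv A dA a" "has_sphere_deriv R dR (A a)" "has_sphere_deriv B dB (R (A a))" for dA dR dB a
    unfolding f_def using that by (intro has_sphere_deriv_comp) (simp_all add: o_def)
  have f_hol: "\<exists>D. has_sphere_deriv f D a" for a
    using chain moebius_map_has_sphere_deriv[OF A(1)] moebius_map_has_sphere_deriv[OF B(1)]
      rational_map_has_sphere_deriv[OF assms(1)] by metis
  have f0: "f (Some 0) = Some 0" and finf: "f None = None"
    by (simp_all add: f_def A Bx By)
  have ninj: "\<not> inj f"
  proof
    assume "inj f"
    have "R = B' \<circ> f \<circ> A'"
      unfolding f_def fun_eq_iff comp_apply using A'(2) B(3) by (metis comp_apply id_apply)
    moreover have "inj B'" "inj A'"
      using B(2) A'(2) by (metis inj_on_id inj_on_imageI2)+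
    ultimately have "inj R"
      using \<open>inj f\<close> by (simp add: inj_compose)
    then show False
      using rational_map_not_inj[OF assms(1,2)] by blast
  qed
  obtain dA where dA: "has_sphere_deriv A dA (Some 0)" "dA \<noteq> 0" using moebius_map_has_sphere_deriv[OF A(1)] .
  obtain dR where dR: "has_sphere_deriv R dR x" using rational_map_has_sphere_deriv[OF assms(1)] by blast
  have dR0: "dR \<noteq> 0" using assms(4) local_deriv_eq[OF dR] by (simp add: critical_point_def)
  obtain dB where dB: "has_sphere_deriv B dB (R x)" "dB \<noteq> 0" using moebius_map_has_sphere_deriv[OF B(1)] .
  define d where "d = dB * (dR * dA)"
  have d: "has_sphere_deriv f d (Some 0)" "d \<noteq> 0"
    unfolding d_def using chain[of dA "Some 0"] dA dR dB dR0 A(2) by simp_all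
  obtain \<zeta> v where f\<zeta>: "f (Some \<zeta>) = Some v" "v \<noteq> 0" and crit: "has_sphere_deriv f 0 (Some \<zeta>)"
    and less: "cmod v < 4 * cmod \<zeta> * cmod d"
    using critical_point_quarter_normalized[OF f_hol f0 finf ninj d] .
  have \<zeta>0: "\<zeta> \<noteq> 0" using less by auto
  define s where "s = \<zeta> / v"
  have s0: "s \<noteq> 0" using \<zeta>0 f\<zeta> by (simp add: s_def)
  note S = moebius_of_scale[OF s0]
  define M where "M = A \<circ> (moebius_of s 0 0 1 \<circ> B)"
  have "moebius_map M" unfolding M_def by (intro moebius_map_comp A B S)
  moreover have "(M \<circ> R) x = x" "(M \<circ> R) y = y"
    by (simp_all add: M_def Bx By S A)
  moreover have "(M \<circ> R) (A (Some \<zeta>)) = A (Some \<zeta>)"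
  proof -
    have "B (R (A (Some \<zeta>))) = Some v" using f\<zeta>(1) by (simp add: f_def)
    moreover have "s * v = \<zeta>" using f\<zeta>(2) by (simp add: s_def)
    ultimately show ?thesis by (simp add: M_def S)
  qed
  moreover have "critical_point R (A (Some \<zeta>))"
  proof -
    obtain a where a: "has_sphere_deriv A a (Some \<zeta>)" "a \<noteq> 0"
      using moebius_map_has_sphere_deriv[OF A(1)] .
    obtain r where r: "has_sphere_deriv R r (A (Some \<zeta>))"
      using rational_map_has_sphere_deriv[OF assms(1)] by blast
    obtain b where b: "has_sphere_deriv B b (R (A (Some \<zeta>)))" "b \<noteq> 0"
      using moebius_map_has_sphere_deriv[OF B(1)] .
    have "b * (r * a) = 0"
      using has_sphere_deriv_unique[OF chain[OF a(1) r b(1)] crit] .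
    then show ?thesis
      using a b local_deriv_eq[OF r] by (simp add: critical_point_def)
  qed
  moreover have "1 / 4 < cmod (multiplier (M \<circ> R) x)"
  proof -
    obtain m where m: "has_sphere_deriv M m (R x)"
      using moebius_map_has_sphere_deriv[OF \<open>moebius_map M\<close>] .
    have MR: "has_sphere_deriv (M \<circ> R) (m * dR) x"
      using has_sphere_deriv_comp[OF dR m] .
    \<comment> \<open>\<open>A\<close> conjugates \<open>w \<mapsto> s f(w)\<close> to \<open>M \<circ> R\<close>; comparing derivatives, that of \<open>A\<close> cancels.\<close>
    have 1: "has_sphere_deriv ((M \<circ> R) \<circ> A) (m * dR * dA) (Some 0)"
      using has_sphere_deriv_comp[OF dA(1)] MR A(2) by simp
    have 2: "has_sphere_deriv (A \<circ> (moebius_of s 0 0 1 \<circ> f)) (dA * (s * d)) (Some 0)"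
      using d dA S by (intro has_sphere_deriv_comp) (simp_all add: f0)
    have "(M \<circ> R) \<circ> A = A \<circ> (moebius_of s 0 0 1 \<circ> f)"
      by (simp add: M_def f_def o_assoc)
    then have "m * dR * dA = dA * (s * d)"
      using 1 2 has_sphere_deriv_unique by metis
    then have "m * dR = s * d" using dA(2) by simp
    moreover have "multiplier (M \<circ> R) x = m * dR"
      using local_deriv_eq[OF MR] \<open>(M \<circ> R) x = x\<close> by (simp add: multiplier_def)
    ultimately have "cmod v * cmod (multiplier (M \<circ> R) x) = cmod \<zeta> * cmod d"
      using f\<zeta>(2) by (simp add: s_def norm_mult norm_divide)
    then have "cmod v * 1 < cmod v * (4 * cmod (multiplier (M \<circ> R) x))"
      using less by simp
    then show ?thesis by (simp add: mult_less_cancel_left_pos f\<zeta>(2))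
  qed
  ultimately show ?thesis by blast
qed

end
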